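(* Let $\{\mathcal G,\Gamma_0,\Gamma_1\}$ be a quasi boundary triple for $T\subset A^*$ with $A_0=T\upharpoonright\ker\Gamma_0$ and Weyl function $M$. Assume that there exists $\eta\in\rho(A_0)\cap\mathbb R$ and that $\mathscr G_1=\operatorname{ran}(\Gamma_1\upharpoonright\ker\Gamma_0)$ is dense in $\mathcal G$. Then the mapping $$\Theta\mapsto A_\vartheta=T\upharpoonright\{f\in\operatorname{dom}T:\Gamma f\in\vartheta\}\quad\text{with}\quad\vartheta=\iota_+^{-1}\Theta\iota_-+M(\eta)$$ establishes a bijective correspondence between all closed (symmetric, self-adjoint, (maximal) dissipative, (maximal) accumulative) linear relations $\Theta$ in $\mathcal G$ with $\operatorname{dom}\Theta\subset\operatorname{ran}(\iota_-\Gamma_0)$ and all closed (symmetric, self-adjoint, (maximal) dissipative, (maximal) accumulative, respectively) extensions $A_\vartheta\subset T$ of $A$ in $\mathcal H$.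
   Context: Inner products are linear in the first and antilinear in the second argument. $\mathcal H$ is a separable Hilbert space, $A$ is a closed, densely defined, symmetric operator in $\mathcal H$ with equal (in general infinite) deficiency indices and adjoint $A^*$. Quasi boundary triple: let $T\subset A^*$ be a linear operator in $\mathcal H$ with $\overline T=A^*$. A triple $\{\mathcal G,\Gamma_0,\Gamma_1\}$ is a quasi boundary triple for $T\subset A^*$ if $\mathcal G$ is a Hilbert space and $\Gamma_0,\Gamma_1:\operatorname{dom}T\to\mathcal G$ are linear maps such that (a) $(Tf,g)_{\mathcal H}-(f,Tg)_{\mathcal H}=(\Gamma_1f,\Gamma_0g)_{\mathcal G}-(\Gamma_0f,\Gamma_1g)_{\mathcal G}$ for all $f,g\in\operatorname{dom}T$; (b) $\Gamma=(\Gamma_0,\Gamma_1)^\top:\operatorname{dom}T\to\mathcal G\times\mathcal G$ has dense range; (c) $A_0:=T\upharpoonright\ker\Gamma_0$ is self-adjoint in $\mathcal H$. For $\lambda\in\rho(A_0)$: $\gamma(\lambda):=(\Gamma_0\upharpoonright\ker(T-\lambda))^{-1}$ and the Weyl function is $M(\lambda):=\Gamma_1\gamma(\lambda)$, with domain $\operatorname{ran}\Gamma_0\subset\mathcal G$. The space $\mathscr G_1$ is equipped with a norm such that $\mathscr G_1$ is a reflexive Banach space continuously embedded in $\mathcal G$ and $\Gamma_1(A_0-\bar\lambda)^{-1}:\mathcal H\to\mathscr G_1$ is continuous for some (equivalently all) $\lambda\in\rho(A_0)$ (such a norm exists when $\mathscr G_1$ is dense, and all such norms are equivalent). $\mathscr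 G_1'$ is the anti-dual (continuous antilinear functionals), $\mathscr G_1\hookrightarrow\mathcal G\hookrightarrow\mathscr G_1'$, with pairing extending $(\cdot,\cdot)_{\mathcal G}$. $\iota_+:\mathscr G_1\to\mathcal G$ and $\iota_-:\mathscr G_1'\to\mathcal G$ are isometric isomorphisms with $(\iota_-x',\iota_+x)_{\mathcal G}=\langle x',x\rangle_{\mathscr G_1'\times\mathscr G_1}$ for $x\in\mathscr G_1$, $x'\in\mathscr G_1'$. Linear relations: a (closed) linear relation $\Theta$ in $\mathcal G$ is a (closed) linear subspace of $\mathcal G\times\mathcal G$; operators are identified with their graphs. $\operatorname{dom}\Theta=\{x:(x,x')^\top\in\Theta\text{ for some }x'\}$. Sum: $\Theta_1+\Theta_2=\{(x,x'+x'')^\top:(x,x')^\top\in\Theta_1,(x,x'')^\top\in\Theta_2\}$; product: $\Theta_2\Theta_1=\{(x,x'')^\top:(x,x')^\top\in\Theta_1,(x',x'')^\top\in\Theta_2\}$; so $\iota_+^{-1}\Theta\iota_-=\{(h,\iota_+^{-1}x')^\top:(\iota_-h,x')^\top\in\Theta\}\subset\mathscr G_1'\times\mathscr G_1$. Adjoint: $\Theta^*=\{(y,y')^\top:(x',y)=(x,y')\text{ for all }(x,x')^\top\in\Theta\}$. $\Theta$ is symmetric if $\Theta\subset\Theta^*$, self-adjoint if $\Theta=\Theta^*$, dissipative (accumulative) if $\operatorname{Im}(x',x)\ge0$ ($\le0$) for all $(x,x')^\top\in\Theta$, and maximal dissipative (accumulative) if it is dissipative (accumulative) without proper dissipative (accumulative)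 extensions; likewise for operators. The parenthetical list means that the correspondence holds for each of the listed properties separately, with the same property on both sides. *)

theory Defs
  imports "HOL-Analysis.Analysis" "HOL-Library.Equipollence"
begin

section \<open>Complex Hilbert spaces\<close>

text \<open>
  A complex inner product space is presented as a real one (whose norm and topology it keeps)
  together with a complex scalar multiplication and a sesquilinear form, linear in the first and
  antilinear in the second argument, whose real part is the real inner product.
\<close>

class complex_inner = real_inner +
  fixes scaleC :: "complex \<Rightarrow> 'a \<Rightarrow> 'a" (infixr "*\<^sub>C" 75)
    and cinner :: "'a \<Rightarrow> 'a \<Rightarrow> complex"
  assumes scaleC_add_right: "c *\<^sub>C (x + y) = c *\<^sub>C x + c *\<^sub>C y"
    and scaleC_add_left: "(c + d) *\<^sub>C x = c *\<^sub>C x + d *\<^sub>C x"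
    and scaleC_scaleC: "c *\<^sub>C (d *\<^sub>C x) = (c * d) *\<^sub>C x"
    and scaleC_of_real: "complex_of_real r *\<^sub>C x = r *\<^sub>R x"
    and cinner_commute: "cinner x y = cnj (cinner y x)"
    and cinner_add_left: "cinner (x + y) z = cinner x z + cinner y z"
    and cinner_scaleC_left: "cinner (c *\<^sub>C x) y = c * cinner x y"
    and Re_cinner: "Re (cinner x y) = inner x y"

class chilbert_space = complex_inner + complete_space

definition clinear_on :: "'a::complex_inner set \<Rightarrow> ('a \<Rightarrow> 'b::complex_inner) \<Rightarrow> bool" where
  "clinear_on D F \<longleftrightarrow>
     (\<forall>x\<in>D. \<forall>y\<in>D. F (x + y) = F x + F y) \<and> (\<forall>c. \<forall>x\<in>D. F (c *\<^sub>C x) = c *\<^sub>C F x)"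


section \<open>Linear relations and operators\<close>

text \<open>
  Operators are identified with their graphs. Domains are given by \<^const>\<open>Domain\<close>; closedness is
  topological closedness of the graph. The predicates \<open>rel_symmetric\<close>, \<open>rel_selfadjoint\<close>,
  \<open>dissipative\<close> and \<open>accumulative\<close> do not include linearity.
\<close>

definition linear_relation :: "('a::complex_inner \<times> 'b::complex_inner) set \<Rightarrow> bool" where
  "linear_relation R \<longleftrightarrow>
     (0, 0) \<in> R \<and>
     (\<forall>(x, x')\<in>R. \<forall>(y, y')\<in>R. (x + y, x' + y') \<in> R) \<and>
     (\<forall>c. \<forall>(x, x')\<in>R. (c *\<^sub>C x, c *\<^sub>C x') \<in> R)"

definition linear_operator :: "('a::complex_inner \<times> 'b::complex_inner) set \<Rightarrow> bool" where
  "linear_operator R \<longleftrightarrow> linear_relation R \<and> single_valued R"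

definition graph_on :: "'a set \<Rightarrow> ('a \<Rightarrow> 'b) \<Rightarrow> ('a \<times> 'b) set" where
  "graph_on D F = {(x, F x) | x. x \<in> D}"

definition rel_sum :: "('a \<times> 'b::plus) set \<Rightarrow> ('a \<times> 'b) set \<Rightarrow> ('a \<times> 'b) set" where
  "rel_sum R S = {(x, x' + x'') | x x' x''. (x, x') \<in> R \<and> (x, x'') \<in> S}"

definition rel_adjoint :: "('a::complex_inner \<times> 'a) set \<Rightarrow> ('a \<times> 'a) set" where
  "rel_adjoint R = {(y, y'). \<forall>(x, x')\<in>R. cinner x' y = cinner x y'}"

definition rel_symmetric :: "('a::complex_inner \<times> 'a) set \<Rightarrow> bool" where
  "rel_symmetric R \<longleftrightarrow> R \<subseteq> rel_adjoint R"

definition rel_selfadjoint :: "('a::complex_inner \<times> 'a) set \<Rightarrow> bool" where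
  "rel_selfadjoint R \<longleftrightarrow> R = rel_adjoint R"

definition dissipative :: "('a::complex_inner \<times> 'a) set \<Rightarrow> bool" where
  "dissipative R \<longleftrightarrow> (\<forall>(x, x')\<in>R. Im (cinner x' x) \<ge> 0)"

definition accumulative :: "('a::complex_inner \<times> 'a) set \<Rightarrow> bool" where
  "accumulative R \<longleftrightarrow> (\<forall>(x, x')\<in>R. Im (cinner x' x) \<le> 0)"

text \<open>
  The class \<open>C\<close> is \<^const>\<open>linear_relation\<close> or \<^const>\<open>linear_operator\<close>: maximality of a relation is
  tested against relations, maximality of an operator against operators.
\<close>

definition maximal_with ::
  "('a set \<Rightarrow> bool) \<Rightarrow> ('a set \<Rightarrow> bool) \<Rightarrow> 'a set \<Rightarrow> bool" where
  "maximal_with C P R \<longleftrightarrow> C R \<and> P R \<and> (\<forall>S. C S \<and> P S \<and> R \<subseteq> S \<longrightarrow> S = R)"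

definition eigenspace :: "('a::complex_inner \<times> 'a) set \<Rightarrow> complex \<Rightarrow> 'a set" where
  "eigenspace R \<mu> = {f. (f, \<mu> *\<^sub>C f) \<in> R}"

text \<open>The relation \<open>(R - \<mu>)\<^sup>-\<^sup>1\<close>.\<close>

definition resolvent :: "('a::complex_inner \<times> 'a) set \<Rightarrow> complex \<Rightarrow> ('a \<times> 'a) set" where
  "resolvent R \<mu> = {(f' - \<mu> *\<^sub>C f, f) | f f'. (f, f') \<in> R}"

definition resolvent_set :: "('a::complex_inner \<times> 'a) set \<Rightarrow> complex set" where
  "resolvent_set R =
     {\<mu>. single_valued (resolvent R \<mu>) \<and> Domain (resolvent R \<mu>) = UNIV \<and>
         (\<exists>K. \<forall>(g, f)\<in>resolvent R \<mu>. norm f \<le> K * norm g)}"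

text \<open>Orthonormal bases of a closed subspace \<open>S\<close>, as total orthonormal systems.\<close>

definition orthonormal_basis :: "'a::complex_inner set \<Rightarrow> 'a set \<Rightarrow> bool" where
  "orthonormal_basis S B \<longleftrightarrow>
     B \<subseteq> S \<and> (\<forall>b\<in>B. cinner b b = 1) \<and> (\<forall>b\<in>B. \<forall>c\<in>B. b \<noteq> c \<longrightarrow> cinner b c = 0) \<and>
     (\<forall>x\<in>S. (\<forall>b\<in>B. cinner x b = 0) \<longrightarrow> x = 0)"

text \<open>
  The deficiency indices are the Hilbert space dimensions of \<open>ker (A\<^sup>* - \<i>)\<close> and
  \<open>ker (A\<^sup>* + \<i>)\<close>, possibly infinite.
\<close>

definition equal_deficiency_indices :: "('a::complex_inner \<times> 'a) set \<Rightarrow> bool" where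
  "equal_deficiency_indices A \<longleftrightarrow>
     (\<exists>B C. orthonormal_basis (eigenspace (rel_adjoint A) \<i>) B \<and>
            orthonormal_basis (eigenspace (rel_adjoint A) (- \<i>)) C \<and> B \<approx> C)"


section \<open>Quasi boundary triples\<close>

definition A0 :: "('h \<times> 'h) set \<Rightarrow> ('h \<Rightarrow> 'g::zero) \<Rightarrow> ('h \<times> 'h) set" where
  "A0 T \<Gamma>\<^sub>0 = {(f, f') \<in> T. \<Gamma>\<^sub>0 f = 0}"

text \<open>Only the values of \<open>\<Gamma>\<^sub>0\<close> and \<open>\<Gamma>\<^sub>1\<close> on \<open>Domain T\<close> matter.\<close>

definition quasi_boundary_triple ::
  "('h::chilbert_space \<times> 'h) set \<Rightarrow> ('h \<times> 'h) set \<Rightarrow>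
   ('h \<Rightarrow> 'g::chilbert_space) \<Rightarrow> ('h \<Rightarrow> 'g) \<Rightarrow> bool" where
  "quasi_boundary_triple A T \<Gamma>\<^sub>0 \<Gamma>\<^sub>1 \<longleftrightarrow>
     linear_operator T \<and> T \<subseteq> rel_adjoint A \<and> closure T = rel_adjoint A \<and>
     clinear_on (Domain T) \<Gamma>\<^sub>0 \<and> clinear_on (Domain T) \<Gamma>\<^sub>1 \<and>
     (\<forall>(f, f')\<in>T. \<forall>(g, g')\<in>T.
        cinner f' g - cinner f g' = cinner (\<Gamma>\<^sub>1 f) (\<Gamma>\<^sub>0 g) - cinner (\<Gamma>\<^sub>0 f) (\<Gamma>\<^sub>1 g)) \<and>
     closure ((\<lambda>f. (\<Gamma>\<^sub>0 f, \<Gamma>\<^sub>1 f)) ` Domain T) = UNIV \<and>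
     rel_selfadjoint (A0 T \<Gamma>\<^sub>0)"

definition gamma_field ::
  "('h::complex_inner \<times> 'h) set \<Rightarrow> ('h \<Rightarrow> 'g) \<Rightarrow> complex \<Rightarrow> ('g \<times> 'h) set" where
  "gamma_field T \<Gamma>\<^sub>0 \<mu> = (graph_on (eigenspace T \<mu>) \<Gamma>\<^sub>0)\<inverse>"

definition weyl_function ::
  "('h::complex_inner \<times> 'h) set \<Rightarrow> ('h \<Rightarrow> 'g) \<Rightarrow> ('h \<Rightarrow> 'g) \<Rightarrow> complex \<Rightarrow> ('g \<times> 'g) set" where
  "weyl_function T \<Gamma>\<^sub>0 \<Gamma>\<^sub>1 \<mu> = gamma_field T \<Gamma>\<^sub>0 \<mu> O graph_on (Domain T) \<Gamma>\<^sub>1"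

definition G1 :: "('h \<times> 'h) set \<Rightarrow> ('h \<Rightarrow> 'g::zero) \<Rightarrow> ('h \<Rightarrow> 'g) \<Rightarrow> 'g set" where
  "G1 T \<Gamma>\<^sub>0 \<Gamma>\<^sub>1 = \<Gamma>\<^sub>1 ` {f \<in> Domain T. \<Gamma>\<^sub>0 f = 0}"


section \<open>Normed subspaces and their anti-duals\<close>

text \<open>
  In this section \<open>S\<close> is a linear subspace of the ambient space carrying its own norm \<open>n\<close>, of which
  only the values on \<open>S\<close> matter.
\<close>

definition banach_norm_on :: "'a::complex_inner set \<Rightarrow> ('a \<Rightarrow> real) \<Rightarrow> bool" where
  "banach_norm_on S n \<longleftrightarrow>
     (\<forall>x\<in>S. n x \<ge> 0 \<and> (n x = 0 \<longleftrightarrow> x = 0)) \<and>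
     (\<forall>c. \<forall>x\<in>S. n (c *\<^sub>C x) = cmod c * n x) \<and>
     (\<forall>x\<in>S. \<forall>y\<in>S. n (x + y) \<le> n x + n y) \<and>
     (\<forall>X. (\<forall>k::nat. X k \<in> S) \<and> (\<forall>e>0. \<exists>N. \<forall>k\<ge>N. \<forall>m\<ge>N. n (X k - X m) < e)
        \<longrightarrow> (\<exists>x\<in>S. (\<lambda>k. n (X k - x)) \<longlonglongrightarrow> 0))"

text \<open>
  Continuous antilinear functionals on \<open>S\<close>, extended by zero outside \<open>S\<close> so that equality of
  functions is equality of functionals; the pairing of \<open>\<phi>\<close> with \<open>x\<close> is \<open>\<phi> x\<close>.
\<close>

definition antidual :: "'a::complex_inner set \<Rightarrow> ('a \<Rightarrow> real) \<Rightarrow> ('a \<Rightarrow> complex) set" where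
  "antidual S n =
     {\<phi>. (\<forall>x. x \<notin> S \<longrightarrow> \<phi> x = 0) \<and>
         (\<forall>x\<in>S. \<forall>y\<in>S. \<phi> (x + y) = \<phi> x + \<phi> y) \<and>
         (\<forall>c. \<forall>x\<in>S. \<phi> (c *\<^sub>C x) = cnj c * \<phi> x) \<and>
         (\<exists>K. \<forall>x\<in>S. cmod (\<phi> x) \<le> K * n x)}"

definition antidual_norm :: "'a set \<Rightarrow> ('a \<Rightarrow> real) \<Rightarrow> ('a \<Rightarrow> complex) \<Rightarrow> real" where
  "antidual_norm S n \<phi> = Sup {cmod (\<phi> x) | x. x \<in> S \<and> n x \<le> 1}"

text \<open>
  Reflexivity: every continuous antilinear functional on the anti-dual is of the form
  \<open>\<phi> \<mapsto> cnj (\<phi> x)\<close>; the conjugate makes the canonical embedding into the anti-bidual linear.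
\<close>

definition reflexive_norm_on :: "'a::complex_inner set \<Rightarrow> ('a \<Rightarrow> real) \<Rightarrow> bool" where
  "reflexive_norm_on S n \<longleftrightarrow>
     (\<forall>F. (\<forall>\<phi>\<in>antidual S n. \<forall>\<psi>\<in>antidual S n. F (\<lambda>x. \<phi> x + \<psi> x) = F \<phi> + F \<psi>) \<and>
          (\<forall>c. \<forall>\<phi>\<in>antidual S n. F (\<lambda>x. c * \<phi> x) = cnj c * F \<phi>) \<and>
          (\<exists>K. \<forall>\<phi>\<in>antidual S n. cmod (F \<phi>) \<le> K * antidual_norm S n \<phi>)
        \<longrightarrow> (\<exists>x\<in>S. \<forall>\<phi>\<in>antidual S n. F \<phi> = cnj (\<phi> x)))"

text \<open>The embedding of the ambient Hilbert space into the anti-dual.\<close>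

definition into_antidual :: "'a::complex_inner set \<Rightarrow> 'a \<Rightarrow> 'a \<Rightarrow> complex" where
  "into_antidual S g = (\<lambda>x. if x \<in> S then cinner g x else 0)"

definition admissible_norm ::
  "('h::chilbert_space \<times> 'h) set \<Rightarrow> ('h \<Rightarrow> 'g::chilbert_space) \<Rightarrow> ('h \<Rightarrow> 'g) \<Rightarrow>
   ('g \<Rightarrow> real) \<Rightarrow> bool" where
  "admissible_norm T \<Gamma>\<^sub>0 \<Gamma>\<^sub>1 n \<longleftrightarrow>
     banach_norm_on (G1 T \<Gamma>\<^sub>0 \<Gamma>\<^sub>1) n \<and> reflexive_norm_on (G1 T \<Gamma>\<^sub>0 \<Gamma>\<^sub>1) n \<and>
     (\<exists>K. \<forall>x\<in>G1 T \<Gamma>\<^sub>0 \<Gamma>\<^sub>1. norm x \<le> K * n x) \<and>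
     (\<exists>\<mu>\<in>resolvent_set (A0 T \<Gamma>\<^sub>0). \<exists>K.
        \<forall>(g, f)\<in>resolvent (A0 T \<Gamma>\<^sub>0) (cnj \<mu>). n (\<Gamma>\<^sub>1 f) \<le> K * norm g)"

definition iota_pair ::
  "'g::chilbert_space set \<Rightarrow> ('g \<Rightarrow> real) \<Rightarrow> ('g \<Rightarrow> 'g) \<Rightarrow> (('g \<Rightarrow> complex) \<Rightarrow> 'g) \<Rightarrow> bool" where
  "iota_pair S n \<iota>\<^sub>p \<iota>\<^sub>m \<longleftrightarrow>
     clinear_on S \<iota>\<^sub>p \<and> bij_betw \<iota>\<^sub>p S UNIV \<and> (\<forall>x\<in>S. norm (\<iota>\<^sub>p x) = n x) \<and>
     (\<forall>\<phi>\<in>antidual S n. \<forall>\<psi>\<in>antidual S n. \<iota>\<^sub>m (\<lambda>x. \<phi> x + \<psi> x) = \<iota>\<^sub>m \<phi> + \<iota>\<^sub>m \<psi>) \<and>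
     (\<forall>c. \<forall>\<phi>\<in>antidual S n. \<iota>\<^sub>m (\<lambda>x. c * \<phi> x) = c *\<^sub>C \<iota>\<^sub>m \<phi>) \<and>
     bij_betw \<iota>\<^sub>m (antidual S n) UNIV \<and>
     (\<forall>\<phi>\<in>antidual S n. norm (\<iota>\<^sub>m \<phi>) = antidual_norm S n \<phi>) \<and>
     (\<forall>\<phi>\<in>antidual S n. \<forall>x\<in>S. cinner (\<iota>\<^sub>m \<phi>) (\<iota>\<^sub>p x) = \<phi> x)"


section \<open>The parametrization of extensions\<close>

text \<open>
  The relation \<open>\<iota>\<^sub>+\<^sup>-\<^sup>1 \<Theta> \<iota>\<^sub>-\<close> between the anti-dual of \<open>S\<close> and \<open>S\<close>. Note that \<^const>\<open>relcomp\<close>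
  composes from left to right.
\<close>

definition iota_conj ::
  "'g::complex_inner set \<Rightarrow> ('g \<Rightarrow> real) \<Rightarrow> ('g \<Rightarrow> 'g) \<Rightarrow> (('g \<Rightarrow> complex) \<Rightarrow> 'g) \<Rightarrow>
   ('g \<times> 'g) set \<Rightarrow> (('g \<Rightarrow> complex) \<times> 'g) set" where
  "iota_conj S n \<iota>\<^sub>p \<iota>\<^sub>m \<Theta> = graph_on (antidual S n) \<iota>\<^sub>m O \<Theta> O (graph_on S \<iota>\<^sub>p)\<inverse>"

text \<open>
  \<open>\<theta> = \<iota>\<^sub>+\<^sup>-\<^sup>1 \<Theta> \<iota>\<^sub>- + M(\<mu>)\<close>. The domain of \<open>M(\<mu>)\<close> lies in the Hilbert space, so the first summand
  is read there, through the embedding into the anti-dual.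
\<close>

definition theta ::
  "('h::complex_inner \<times> 'h) set \<Rightarrow> ('h \<Rightarrow> 'g::complex_inner) \<Rightarrow> ('h \<Rightarrow> 'g) \<Rightarrow> ('g \<Rightarrow> real) \<Rightarrow>
   ('g \<Rightarrow> 'g) \<Rightarrow> (('g \<Rightarrow> complex) \<Rightarrow> 'g) \<Rightarrow> complex \<Rightarrow> ('g \<times> 'g) set \<Rightarrow> ('g \<times> 'g) set" where
  "theta T \<Gamma>\<^sub>0 \<Gamma>\<^sub>1 n \<iota>\<^sub>p \<iota>\<^sub>m \<mu> \<Theta> =
     rel_sum
       (graph_on UNIV (into_antidual (G1 T \<Gamma>\<^sub>0 \<Gamma>\<^sub>1)) O iota_conj (G1 T \<Gamma>\<^sub>0 \<Gamma>\<^sub>1) n \<iota>\<^sub>p \<iota>\<^sub>m \<Theta>)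
       (weyl_function T \<Gamma>\<^sub>0 \<Gamma>\<^sub>1 \<mu>)"

definition A_rel ::
  "('h \<times> 'h) set \<Rightarrow> ('h \<Rightarrow> 'g) \<Rightarrow> ('h \<Rightarrow> 'g) \<Rightarrow> ('g \<times> 'g) set \<Rightarrow> ('h \<times> 'h) set" where
  "A_rel T \<Gamma>\<^sub>0 \<Gamma>\<^sub>1 \<theta> = {(f, f') \<in> T. (\<Gamma>\<^sub>0 f, \<Gamma>\<^sub>1 f) \<in> \<theta>}"

definition intermediate_operators :: "('h::complex_inner \<times> 'h) set \<Rightarrow> ('h \<times> 'h) set \<Rightarrow> ('h \<times> 'h) set set"
  where "intermediate_operators A T = {B. linear_operator B \<and> A \<subseteq> B \<and> B \<subseteq> T}"

end

theory Submission
  imports Defs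
begin

text \<open>
  After regularization, the quasi boundary triple is the restriction of an ordinary boundary triple
  for the adjoint of \<open>A\<close>, and for an ordinary boundary triple the correspondence is elementary.

  Suppose first that a map \<open>\<Phi>\<close> from the graph of the adjoint of \<open>A\<close> onto the product of the boundary
  space with itself satisfies Green's identity. The difference of the two sides of Green's identity
  is an indefinite form on pairs (\<open>green_form\<close>), which \<open>\<Phi>\<close> preserves. Taking preimages under \<open>\<Phi>\<close> is
  a bijection from the linear relations in the boundary space onto the linear relations between \<open>A\<close>
  and its adjoint, because the kernel of \<open>\<Phi>\<close> is \<open>A\<close>. Symmetry, dissipativity and accumulativity
  are conditions on the values of the form, and the adjoint of a relation is its orthogonal
  complement for the form; so taking preimages commutes with adjoints (\<open>rel_adjoint_pull\<close>).
  Closedness transfers along with adjoints, since a linear relation is closed exactly if it equals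
  its second adjoint. For maximality one also has to know that a dissipative extension of a symmetric
  relation is contained in its adjoint (\<open>semidefinite_extension_subset_rel_adjoint\<close>).

  It remains to find \<open>\<Phi>\<close>. Write \<open>R = (A\<^sub>0 - \<eta>)\<^sup>-\<^sup>1\<close> and \<open>P = \<iota>\<^sub>+ \<Gamma>\<^sub>1 R\<close>, which is a bounded operator onto
  the boundary space. For \<open>f\<close> in the domain of \<open>T\<close> the element \<open>R (T - \<eta>) f\<close> is the component of \<open>f\<close> in
  the domain of \<open>A\<^sub>0\<close>, and \<open>P (T - \<eta>) f = \<iota>\<^sub>+ (\<Gamma>\<^sub>1 f - M(\<eta>) \<Gamma>\<^sub>0 f)\<close>. Thus \<open>f\<close> is in the domain of
  \<open>A\<^sub>\<theta>\<close> if and only if the pair of \<open>\<iota>\<^sub>- \<Gamma>\<^sub>0 f\<close> and \<open>P (T - \<eta>) f\<close> is in \<open>\<Theta>\<close>. The second entry of this pair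
  makes sense on the whole adjoint of \<open>A\<close>. Green's identity shows that the first entry, \<open>x\<close>, satisfies
  \<open>(x, P h) = (f, h) - ((T - \<eta>) f, R h)\<close> for all \<open>h\<close>. Approximation by elements of \<open>T\<close> and the
  principle of uniform boundedness show that this equation has a solution \<open>x\<close> for all pairs in the
  adjoint (\<open>exists_extended_trace\<close>); this defines \<open>\<Phi>\<close>. It is onto since \<open>P\<close> is onto and \<open>P\<^sup>*\<close>
  maps into the eigenspace of the adjoint at \<open>\<eta>\<close> (\<open>\<Phi>_onto\<close>). Finally \<open>T\<close> consists of the pairs for
  which \<open>x\<close> is in the range of \<open>\<iota>\<^sub>- \<Gamma>\<^sub>0\<close> (\<open>T_eq_pull\<close>), which accounts for the condition on the domain
  of \<open>\<Theta>\<close>.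
\<close>

section \<open>Complex inner products\<close>

lemma scaleC_one [simp]: "1 *\<^sub>C (x::'a::complex_inner) = x"
  using scaleC_of_real[of 1 x] by simp

lemma scaleC_zero_left [simp]: "0 *\<^sub>C (x::'a::complex_inner) = 0"
  using scaleC_of_real[of 0 x] by simp

lemma scaleC_zero_right [simp]: "c *\<^sub>C (0::'a::complex_inner) = 0"
  using scaleC_add_right[of c 0 0] by simp

lemma scaleC_minus1 [simp]: "(- 1) *\<^sub>C (x::'a::complex_inner) = - x"
  using scaleC_of_real[of "- 1" x] by simp

lemma scaleC_minus_right: "c *\<^sub>C (- x) = - (c *\<^sub>C (x::'a::complex_inner))"
  using scaleC_add_right[of c x "- x"] by (simp add: eq_neg_iff_add_eq_0 add.commute)

lemma scaleC_diff_right: "c *\<^sub>C (x - y) = c *\<^sub>C x - c *\<^sub>C (y::'a::complex_inner)"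
  using scaleC_add_right[of c x "- y"] by (simp add: scaleC_minus_right)

lemma cinner_scaleC_right: "cinner (x::'a::complex_inner) (c *\<^sub>C y) = cnj c * cinner x y"
  by (metis cinner_commute cinner_scaleC_left complex_cnj_mult)

lemma cinner_self: "cinner (x::'a::complex_inner) x = complex_of_real ((norm x)\<^sup>2)"
proof (rule complex_eqI)
  show "Im (cinner x x) = Im (complex_of_real ((norm x)\<^sup>2))"
    using arg_cong[OF cinner_commute[of x x], of Im] by simp
qed (simp add: Re_cinner power2_norm_eq_inner)

lemma norm_scaleC: "norm (c *\<^sub>C (x::'a::complex_inner)) = cmod c * norm x"
proof -
  have "complex_of_real ((norm (c *\<^sub>C x))\<^sup>2) = (c * cnj c) * cinner x x"
    unfolding cinner_self[symmetric] by (simp add: cinner_scaleC_left cinner_scaleC_right)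
  also have "\<dots> = complex_of_real ((cmod c * norm x)\<^sup>2)"
    by (simp add: cinner_self complex_norm_square[symmetric] power_mult_distrib)
  finally have "(norm (c *\<^sub>C x))\<^sup>2 = (cmod c * norm x)\<^sup>2"
    by (simp only: of_real_eq_iff)
  then show ?thesis
    by simp
qed

lemma Cauchy_Schwarz_cinner: "cmod (cinner x y) \<le> norm x * norm (y::'a::complex_inner)"
proof (cases "cinner x y = 0")
  case False
  \<comment> \<open>A phase \<open>u\<close> makes the inner product real, which reduces the claim to the real inequality.\<close>
  define u where "u = cnj (sgn (cinner x y))"
  have "cmod u = 1"
    using False by (simp add: u_def norm_sgn)
  have "u * cinner x y = complex_of_real (cmod (cinner x y))"
    using False unfolding u_def
    by (simp add: sgn_eq field_simps complex_norm_square[symmetric] power2_eq_square)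
  then have "cmod (cinner x y) = inner (u *\<^sub>C x) y"
    by (metis Re_cinner Re_complex_of_real cinner_scaleC_left)
  also have "\<dots> \<le> norm (u *\<^sub>C x) * norm y"
    by (rule norm_cauchy_schwarz)
  finally show ?thesis
    by (simp add: norm_scaleC \<open>cmod u = 1\<close>)
qed simp

lemma bounded_bilinear_cinner:
  "bounded_bilinear (cinner :: 'a::complex_inner \<Rightarrow> 'a \<Rightarrow> complex)"
proof
  fix a a' b b' :: 'a and r :: real
  show "cinner (a + a') b = cinner a b + cinner a' b"
    by (rule cinner_add_left)
  show "cinner a (b + b') = cinner a b + cinner a b'"
    by (metis cinner_add_left cinner_commute complex_cnj_add)
  show "cinner (r *\<^sub>R a) b = r *\<^sub>R cinner a b"
    unfolding scaleC_of_real[symmetric] cinner_scaleC_left scaleR_conv_of_real ..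
  show "cinner a (r *\<^sub>R b) = r *\<^sub>R cinner a b"
    unfolding scaleC_of_real[symmetric] cinner_scaleC_right scaleR_conv_of_real by simp
  show "\<exists>K. \<forall>a b :: 'a. norm (cinner a b) \<le> norm a * norm b * K"
    by (intro exI[of _ 1]) (simp add: Cauchy_Schwarz_cinner)
qed

lemmas cinner_add_right = bounded_bilinear.add_right[OF bounded_bilinear_cinner]
lemmas cinner_diff_left = bounded_bilinear.diff_left[OF bounded_bilinear_cinner]
lemmas cinner_diff_right = bounded_bilinear.diff_right[OF bounded_bilinear_cinner]
lemmas cinner_minus_left [simp] = bounded_bilinear.minus_left[OF bounded_bilinear_cinner]
lemmas cinner_minus_right [simp] = bounded_bilinear.minus_right[OF bounded_bilinear_cinner]
lemmas cinner_zero_left [simp] = bounded_bilinear.zero_left[OF bounded_bilinear_cinner]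
lemmas cinner_zero_right [simp] = bounded_bilinear.zero_right[OF bounded_bilinear_cinner]
lemmas tendsto_cinner [tendsto_intros] = bounded_bilinear.tendsto[OF bounded_bilinear_cinner]
lemmas continuous_on_cinner [continuous_intros] =
  bounded_bilinear.continuous_on[OF bounded_bilinear_cinner]

lemma bounded_linear_scaleC: "bounded_linear ((*\<^sub>C) c :: 'a::complex_inner \<Rightarrow> 'a)"
proof (rule bounded_linear_intro)
  fix x y :: 'a and r :: real
  show "c *\<^sub>C (x + y) = c *\<^sub>C x + c *\<^sub>C y"
    by (rule scaleC_add_right)
  show "c *\<^sub>C (r *\<^sub>R x) = r *\<^sub>R (c *\<^sub>C x)"
    by (simp add: scaleC_of_real[symmetric] scaleC_scaleC mult.commute)
  show "norm (c *\<^sub>C x) \<le> norm x * cmod c"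
    by (simp add: norm_scaleC)
qed

lemmas tendsto_scaleC [tendsto_intros] = bounded_linear.tendsto[OF bounded_linear_scaleC]

lemma cinner_self_eq_0_iff [simp]: "cinner x x = 0 \<longleftrightarrow> x = (0::'a::complex_inner)"
  by (simp add: cinner_self)

text \<open>The imaginary part of a complex inner product is a real part of another one.\<close>

lemma cinner_eqI:
  fixes x x' :: "'a::complex_inner" and y y' :: "'b::complex_inner"
  assumes "\<And>c. inner (c *\<^sub>C x) x' = inner (c *\<^sub>C y) y'"
  shows "cinner x x' = cinner y y'"
proof (rule complex_eqI)
  show "Re (cinner x x') = Re (cinner y y')"
    using assms[of 1] by (simp add: Re_cinner)
  have "Re (- \<i> * cinner x x') = Re (- \<i> * cinner y y')"
    using assms[of "- \<i>"] unfolding Re_cinner[symmetric] cinner_scaleC_left .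
  then show "Im (cinner x x') = Im (cinner y y')"
    by simp
qed

lemma eq_0_of_orthogonal_to_dense:
  assumes "closure S = UNIV" "\<And>x. x \<in> S \<Longrightarrow> cinner x y = 0"
  shows "y = (0::'a::complex_inner)"
proof -
  have "cinner x y = 0" if "x \<in> closure S" for x
    by (rule continuous_constant_on_closure[OF _ assms(2) that]) (intro continuous_intros)
  then have "cinner y y = 0"
    using assms(1) by blast
  then show ?thesis
    by simp
qed

section \<open>Complete inner product spaces\<close>

text \<open>
  Two elements of the subspace whose distances to \<open>v\<close> are nearly minimal are close to each other by
  the parallelogram law, since their midpoint is no closer to \<open>v\<close>. Hence the distance to \<open>v\<close> is
  attained, and the difference \<open>w\<close> between \<open>v\<close> and the nearest point is orthogonal to the subspace.
\<close>

lemma exists_orthogonal_separating: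
  fixes V :: "'a::{real_inner,complete_space} set"
  assumes V: "closed V" "subspace V" and v: "v \<notin> V"
  obtains w where "\<And>x. x \<in> V \<Longrightarrow> inner x w = 0" "inner v w \<noteq> 0"
proof -
  have "0 \<in> V"
    by (rule subspace_0[OF V(2)])
  define d where "d = infdist v V"
  have d0: "0 \<le> d"
    by (simp add: d_def infdist_nonneg)
  have dle: "d\<^sup>2 \<le> (norm (v - x))\<^sup>2" if "x \<in> V" for x
    using infdist_le[OF that, of v] d0 by (simp add: d_def dist_norm power_mono)
  have "\<exists>x\<in>V. (norm (v - x))\<^sup>2 < d\<^sup>2 + inverse (real (Suc k))" for k
  proof -
    have "d < sqrt (d\<^sup>2 + inverse (real (Suc k)))"
      using d0 by (simp add: real_less_rsqrt)
    then have "(INF a\<in>V. dist v a) < sqrt (d\<^sup>2 + inverse (real (Suc k)))"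
      using \<open>0 \<in> V\<close> unfolding d_def by (subst (asm) infdist_notempty) auto
    then obtain x where "x \<in> V" "dist v x < sqrt (d\<^sup>2 + inverse (real (Suc k)))"
      using \<open>0 \<in> V\<close> by (subst (asm) cINF_less_iff) (auto intro!: bdd_belowI[of _ 0])
    moreover from this(2) have "\<not> d\<^sup>2 + inverse (real (Suc k)) \<le> (dist v x)\<^sup>2"
      using real_le_lsqrt[OF zero_le_dist] by (metis linorder_not_le)
    ultimately show ?thesis
      by (auto simp: dist_norm not_le)
  qed
  then obtain X where X: "\<And>k. X k \<in> V"
    and Xd: "\<And>k. (norm (v - X k))\<^sup>2 < d\<^sup>2 + inverse (real (Suc k))"
    by metis
  have close: "(norm (X j - X k))\<^sup>2 \<le> 2 * inverse (real (Suc j)) + 2 * inverse (real (Suc k))"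
    for j k
  proof -
    have "(1/2) *\<^sub>R (X j + X k) \<in> V"
      by (intro subspace_mul subspace_add V X)
    then have "4 * d\<^sup>2 \<le> 4 * (norm (v - (1/2) *\<^sub>R (X j + X k)))\<^sup>2"
      using dle by simp
    moreover have "(norm (X j - X k))\<^sup>2 + 4 * (norm (v - (1/2) *\<^sub>R (X j + X k)))\<^sup>2
        = 2 * (norm (v - X j))\<^sup>2 + 2 * (norm (v - X k))\<^sup>2"
      unfolding power2_norm_eq_inner
      by (simp add: inner_diff_left inner_diff_right inner_add_left inner_add_right inner_commute
          algebra_simps)
    ultimately show ?thesis
      using Xd[of j] Xd[of k] by linarith
  qed
  have "Cauchy X"
  proof (rule metric_CauchyI)
    fix e :: real
    assume "0 < e"
    then obtain N where N: "inverse (real (Suc N)) < e\<^sup>2 / 4"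
      using reals_Archimedean[of "e\<^sup>2 / 4"] by auto
    have "dist (X j) (X k) < e" if "N \<le> j" "N \<le> k" for j k
    proof -
      have "inverse (real (Suc j)) \<le> inverse (real (Suc N))"
        "inverse (real (Suc k)) \<le> inverse (real (Suc N))"
        using that by auto
      then have "(norm (X j - X k))\<^sup>2 < e\<^sup>2"
        using close[of j k] N by linarith
      then show ?thesis
        using \<open>0 < e\<close> by (simp add: dist_norm power2_less_imp_less)
    qed
    then show "\<exists>N. \<forall>j\<ge>N. \<forall>k\<ge>N. dist (X j) (X k) < e"
      by blast
  qed
  then obtain p where p: "X \<longlonglongrightarrow> p"
    using Cauchy_convergent convergent_def by blast
  have "p \<in> V"
    using closed_sequentially[OF V(1) _ p] X by blast
  have "(\<lambda>k. d\<^sup>2 + inverse (real (Suc k))) \<longlonglongrightarrow> d\<^sup>2 + 0"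
    by (intro tendsto_intros LIMSEQ_inverse_real_of_nat)
  moreover have "(\<lambda>k. (norm (v - X k))\<^sup>2) \<longlonglongrightarrow> (norm (v - p))\<^sup>2"
    by (intro tendsto_intros p)
  ultimately have pd: "(norm (v - p))\<^sup>2 \<le> d\<^sup>2"
    using Xd by (intro LIMSEQ_le[where X = "\<lambda>k. (norm (v - X k))\<^sup>2"]) (auto intro: less_imp_le)
  define w where "w = v - p"
  have orth: "inner x w = 0" if "x \<in> V" for x
  proof (cases "x = 0")
    case False
    \<comment> \<open>Moving the nearest point along \<open>x\<close> by the optimal amount \<open>t\<close> must not shorten \<open>w\<close>.\<close>
    define t where "t = inner x w / inner x x"
    have "p + t *\<^sub>R x \<in> V"
      by (intro subspace_add subspace_mul V \<open>p \<in> V\<close> that)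
    then have "(norm w)\<^sup>2 \<le> (norm (w - t *\<^sub>R x))\<^sup>2"
      unfolding w_def diff_diff_eq by (rule order_trans[OF pd dle])
    then have "2 * t * inner x w \<le> t\<^sup>2 * inner x x"
      unfolding power2_norm_eq_inner
      by (simp add: inner_diff_left inner_diff_right inner_commute power2_eq_square algebra_simps)
    also have "\<dots> = t * inner x w"
      using False by (simp add: t_def power2_eq_square)
    finally have "t * inner x w \<le> 0"
      by simp
    then have "(inner x w)\<^sup>2 / inner x x \<le> 0"
      by (simp add: t_def power2_eq_square)
    moreover have "0 < inner x x"
      using False by simp
    ultimately show ?thesis
      by (simp add: divide_le_0_iff)
  qed simp
  have "inner v w = inner w w"
    using orth[OF \<open>p \<in> V\<close>] by (simp add: w_def inner_diff_left)
  moreover have "w \<noteq> 0"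
    using v \<open>p \<in> V\<close> by (auto simp: w_def)
  ultimately have "inner v w \<noteq> 0"
    by simp
  then show ?thesis
    using that orth by blast
qed

text \<open>
  The representing element is a multiple of a vector orthogonal to the kernel of the functional.
\<close>

lemma Riesz_representation:
  fixes f :: "'a::{real_inner,complete_space} \<Rightarrow> real"
  assumes f: "bounded_linear f"
  obtains a where "\<And>x. f x = inner a x"
proof (cases "\<forall>x. f x = 0")
  case True
  then show ?thesis
    using that[of 0] by simp
next
  case False
  then obtain v where v: "f v \<noteq> 0"
    by blast
  interpret bounded_linear f by fact
  have "closed (f -` {0})"
    by (intro closed_vimage continuous_on linear_continuous_on f) auto
  moreover have "subspace (f -` {0})"
    by (auto simp: subspace_def add scaleR)
  ultimately obtain w where w: "\<And>x. x \<in> f -` {0} \<Longrightarrow> inner x w = 0" "inner v w \<noteq> 0"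
    using exists_orthogonal_separating[of "f -` {0}" v] v by auto
  have "f x = inner ((f v / inner v w) *\<^sub>R w) x" for x
  proof -
    have "x - (f x / f v) *\<^sub>R v \<in> f -` {0}"
      using v by (simp add: diff scaleR)
    then have "inner x w = f x / f v * inner v w"
      using w(1) by (fastforce simp: inner_diff_left)
    then show ?thesis
      using v w(2) by (simp add: inner_commute field_simps)
  qed
  then show ?thesis
    using that by blast
qed

text \<open>
  The principle of uniform boundedness, for sequences of functionals: by Baire's theorem one of the
  closed sets on which all functionals are bounded by \<open>m\<close> contains a ball.
\<close>

lemma weakly_bounded_imp_Bseq:
  fixes X :: "nat \<Rightarrow> 'a::{real_inner,complete_space}"
  assumes "\<And>y. Bseq (\<lambda>k. inner (X k) y)"
  shows "Bseq X"
proof -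
  define E where "E m = {y. \<forall>k. \<bar>inner (X k) y\<bar> \<le> real m}" for m
  have closed: "closed (E m)" for m
    unfolding E_def by (intro closed_Collect_all closed_Collect_le continuous_intros)
  have "y \<in> \<Union> (range E)" for y
  proof -
    obtain K where "\<And>k. \<bar>inner (X k) y\<bar> \<le> K"
      using assms[of y] by (auto simp: Bseq_def)
    then have "y \<in> E (nat \<lceil>K\<rceil>)"
      unfolding E_def by (auto intro: order_trans real_nat_ceiling_ge)
    then show ?thesis
      by blast
  qed
  then have "interior (\<Union> (range E)) \<noteq> {}"
    by (metis UNIV_I UNIV_eq_I empty_iff interior_UNIV)
  then obtain m where "interior (E m) \<noteq> {}"
    using Baire_category_alt[of euclidean "range E"] completely_metrizable_space_euclidean closed
    by auto
  then obtain z r where r: "0 < r" "cball z r \<subseteq> E m"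
    by (meson ex_in_conv mem_interior_cball)
  have "norm (X k) \<le> 2 * real m / r" for k
  proof (cases "X k = 0")
    case False
    define x where "x = (r / norm (X k)) *\<^sub>R X k"
    have "norm x = r"
      using False r by (simp add: x_def)
    then have "z + x \<in> E m" "z \<in> E m"
      using r by (auto simp: dist_norm)
    then have "\<bar>inner (X k) (z + x)\<bar> \<le> real m" "\<bar>inner (X k) z\<bar> \<le> real m"
      by (auto simp: E_def)
    then have "inner (X k) x \<le> 2 * real m"
      by (simp add: inner_add_right)
    moreover have "inner (X k) x = r * norm (X k)"
      using False by (simp add: x_def dot_square_norm power2_eq_square)
    ultimately show ?thesis
      using r(1) by (simp add: field_simps)
  qed (use r(1) in simp)
  then show ?thesis
    by (rule BseqI')
qed

section \<open>Adjoints of linear relations\<close>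

lemma linear_relationI:
  assumes "(0, 0) \<in> R"
    and "\<And>x x' y y'. \<lbrakk>(x, x') \<in> R; (y, y') \<in> R\<rbrakk> \<Longrightarrow> (x + y, x' + y') \<in> R"
    and "\<And>c x x'. (x, x') \<in> R \<Longrightarrow> (c *\<^sub>C x, c *\<^sub>C x') \<in> R"
  shows "linear_relation R"
  using assms by (auto simp: linear_relation_def)

lemma linear_relation_zero: "linear_relation R \<Longrightarrow> (0, 0) \<in> R"
  by (simp add: linear_relation_def)

lemma linear_relation_add:
  "\<lbrakk>linear_relation R; (x, x') \<in> R; (y, y') \<in> R\<rbrakk> \<Longrightarrow> (x + y, x' + y') \<in> R"
  by (fastforce simp: linear_relation_def)

lemma linear_relation_scaleC:
  "\<lbrakk>linear_relation R; (x, x') \<in> R\<rbrakk> \<Longrightarrow> (c *\<^sub>C x, c *\<^sub>C x') \<in> R"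
  by (fastforce simp: linear_relation_def)

lemma linear_relation_diff:
  assumes "linear_relation R" "(x, x') \<in> R" "(y, y') \<in> R"
  shows "(x - y, x' - y') \<in> R"
  using linear_relation_add[OF assms(1,2) linear_relation_scaleC[OF assms(1,3), of "- 1"]] by simp

lemma linear_relation_imp_subspace: "linear_relation R \<Longrightarrow> subspace R"
  by (auto simp: subspace_def zero_prod_def scaleC_of_real[symmetric]
      intro: linear_relation_zero linear_relation_add linear_relation_scaleC)

text \<open>
  The indefinite sesquilinear form on the product space that is the difference of the two sides of
  Green's identity. Symmetry, adjoints, dissipativity and accumulativity of a relation are all
  statements about its values on the relation.
\<close>

definition green_form :: "'a::complex_inner \<times> 'a \<Rightarrow> 'a \<times> 'a \<Rightarrow> complex" where
  "green_form z w = cinner (snd z) (fst w) - cinner (fst z) (snd w)"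

lemma green_form_add_left: "green_form (z + z') w = green_form z w + green_form z' w"
  by (simp add: green_form_def cinner_add_left)

lemma green_form_diff_left: "green_form (z - z') w = green_form z w - green_form z' w"
  by (simp add: green_form_def cinner_diff_left)

lemma green_form_scaleC_left:
  "green_form (c *\<^sub>C fst z, c *\<^sub>C snd z) w = c * green_form z w"
  by (simp add: green_form_def cinner_scaleC_left algebra_simps)

lemma green_form_add_right: "green_form z (w + w') = green_form z w + green_form z w'"
  by (simp add: green_form_def cinner_add_right)

lemma green_form_scaleC_right:
  "green_form z (c *\<^sub>C fst w, c *\<^sub>C snd w) = cnj c * green_form z w"
  by (simp add: green_form_def cinner_scaleC_right algebra_simps)

lemma green_form_commute: "green_form z w = - cnj (green_form w z)"
  using cinner_commute[of "snd z" "fst w"] cinner_commute[of "fst z" "snd w"]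
  by (simp add: green_form_def)

lemma green_form_nondegenerate:
  assumes "\<And>w. green_form z w = 0"
  shows "z = 0"
proof -
  have "complex_of_real ((norm (snd z))\<^sup>2 + (norm (fst z))\<^sup>2) = 0"
    using assms[of "(snd z, - fst z)"] by (simp add: green_form_def cinner_self)
  then have "(norm (snd z))\<^sup>2 + (norm (fst z))\<^sup>2 = 0"
    by (simp only: of_real_eq_0_iff)
  then show ?thesis
    by (simp add: prod_eq_iff)
qed

lemma green_form_self: "green_form z z = 2 * \<i> * complex_of_real (Im (cinner (snd z) (fst z)))"
  unfolding green_form_def cinner_commute[of "fst z" "snd z"] by (simp add: complex_diff_cnj)

lemma mem_rel_adjoint_iff: "w \<in> rel_adjoint R \<longleftrightarrow> (\<forall>z\<in>R. green_form z w = 0)"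
  by (cases w) (auto simp: rel_adjoint_def green_form_def)

lemma dissipative_iff: "dissipative R \<longleftrightarrow> (\<forall>z\<in>R. 0 \<le> Im (green_form z z))"
  by (auto simp: dissipative_def green_form_self)

lemma accumulative_iff: "accumulative R \<longleftrightarrow> (\<forall>z\<in>R. Im (green_form z z) \<le> 0)"
  by (auto simp: accumulative_def green_form_self)

lemma rel_symmetric_iff: "rel_symmetric R \<longleftrightarrow> (\<forall>z\<in>R. \<forall>w\<in>R. green_form z w = 0)"
  by (auto simp: rel_symmetric_def mem_rel_adjoint_iff subset_iff)

lemma linear_relation_rel_adjoint: "linear_relation (rel_adjoint R)"
proof -
  have "green_form z (0, 0) = 0" for z :: "'a \<times> 'a"
    by (simp add: green_form_def)
  moreover have "green_form z (x + y, x' + y') = green_form z (x, x') + green_form z (y, y')"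
    for z :: "'a \<times> 'a" and x x' y y'
    using green_form_add_right[of z "(x, x')" "(y, y')"] by simp
  moreover have "green_form z (c *\<^sub>C x, c *\<^sub>C x') = cnj c * green_form z (x, x')"
    for z :: "'a \<times> 'a" and x x' c
    using green_form_scaleC_right[of z c "(x, x')"] by simp
  ultimately show ?thesis
    unfolding linear_relation_def
    by (auto simp: mem_rel_adjoint_iff simp del: split_paired_All)
qed

lemma closed_rel_adjoint: "closed (rel_adjoint R)"
proof -
  have "rel_adjoint R = (\<Inter>z\<in>R. {w. green_form z w = 0})"
    by (auto simp: mem_rel_adjoint_iff)
  moreover have "closed {w. green_form z w = 0}" for z :: "'a \<times> 'a"
    unfolding green_form_def by (intro closed_Collect_eq continuous_intros)
  ultimately show ?thesis
    by (simp add: closed_INT)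
qed

lemma subset_rel_adjoint_rel_adjoint: "R \<subseteq> rel_adjoint (rel_adjoint R)"
proof
  fix z
  assume "z \<in> R"
  then have "green_form w z = 0" if "w \<in> rel_adjoint R" for w
    using that green_form_commute[of w z] by (simp add: mem_rel_adjoint_iff)
  then show "z \<in> rel_adjoint (rel_adjoint R)"
    by (simp add: mem_rel_adjoint_iff[of z])
qed

text \<open>
  A point outside a closed linear relation is separated from it by an orthogonal pair \<open>(a, b)\<close>, and
  orthogonality to \<open>(a, b)\<close> means that the Green form with \<open>(b, -a)\<close> vanishes. Linearity over the
  complex numbers turns real into complex orthogonality.
\<close>

lemma rel_adjoint_rel_adjoint:
  fixes R :: "('a::chilbert_space \<times> 'a) set"
  assumes "linear_relation R" "closed R"
  shows "rel_adjoint (rel_adjoint R) = R"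
proof (intro equalityI subset_rel_adjoint_rel_adjoint subsetI)
  fix v
  assume v: "v \<in> rel_adjoint (rel_adjoint R)"
  show "v \<in> R"
  proof (rule ccontr)
    assume "v \<notin> R"
    then obtain w where w: "\<And>x. x \<in> R \<Longrightarrow> inner x w = 0" "inner v w \<noteq> 0"
      using exists_orthogonal_separating[OF assms(2) linear_relation_imp_subspace[OF assms(1)]]
      by metis
    define u where "u = (snd w, - fst w)"
    have form: "green_form z u = cinner (snd z) (snd w) + cinner (fst z) (fst w)" for z
      by (simp add: u_def green_form_def)
    have Re_form: "Re (green_form z u) = inner z w" for z
      by (simp add: form Re_cinner inner_prod_def)
    have "green_form z u = 0" if "z \<in> R" for z
    proof (rule complex_eqI)
      show "Re (green_form z u) = Re 0"
        using w(1)[OF that] by (simp add: Re_form)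
      have "(- \<i> *\<^sub>C fst z, - \<i> *\<^sub>C snd z) \<in> R"
        using linear_relation_scaleC[OF assms(1)] that by (metis prod.collapse)
      then have "Re (- \<i> * green_form z u) = 0"
        unfolding green_form_scaleC_left[symmetric] Re_form by (rule w(1))
      then show "Im (green_form z u) = Im 0"
        by simp
    qed
    then have "u \<in> rel_adjoint R"
      by (simp add: mem_rel_adjoint_iff)
    then have "green_form v u = 0"
      using v green_form_commute[of v u] by (simp add: mem_rel_adjoint_iff)
    then show False
      using w(2) Re_form[of v] by simp
  qed
qed

lemma closed_iff_rel_adjoint_rel_adjoint:
  fixes R :: "('a::chilbert_space \<times> 'a) set"
  shows "linear_relation R \<Longrightarrow> closed R \<longleftrightarrow> rel_adjoint (rel_adjoint R) = R"
  using rel_adjoint_rel_adjoint closed_rel_adjoint by metis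

lemma single_valued_rel_adjoint:
  assumes "closure (Domain R) = UNIV"
  shows "single_valued (rel_adjoint R)"
proof (rule single_valuedI)
  fix x y y'
  assume "(x, y) \<in> rel_adjoint R" "(x, y') \<in> rel_adjoint R"
  then have "cinner z (y - y') = 0" if "z \<in> Domain R" for z
    using that by (fastforce simp: rel_adjoint_def cinner_diff_right)
  then show "y = y'"
    using eq_0_of_orthogonal_to_dense[OF assms, of "y - y'"] by simp
qed

text \<open>
  As in the proof of the Cauchy-Schwarz inequality, a pair \<open>a\<close> in \<open>S\<close> with \<open>green_form a a = 0\<close> is
  orthogonal to \<open>S\<close> for the form: otherwise adding a large multiple of \<open>a\<close> to a pair in \<open>S\<close> would
  violate semidefiniteness. The pairs in a symmetric relation are of this kind. The sign \<open>\<sigma>\<close> covers the dissipative and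
  the accumulative case.
\<close>

lemma semidefinite_extension_subset_rel_adjoint:
  assumes "rel_symmetric A" "A \<subseteq> S" "linear_relation S"
    and semidef: "\<And>z. z \<in> S \<Longrightarrow> 0 \<le> \<sigma> * Im (green_form z z)" and "\<sigma> \<noteq> 0"
  shows "S \<subseteq> rel_adjoint A"
proof (clarsimp simp only: subset_iff mem_rel_adjoint_iff)
  fix s a
  assume s: "s \<in> S" and a: "a \<in> A"
  have "green_form a a = 0"
    using assms(1) a by (simp add: rel_symmetric_iff)
  have "0 \<le> \<sigma> * (Im (green_form s s) + 2 * Im (c * green_form a s))" for c
  proof -
    let ?ca = "(c *\<^sub>C fst a, c *\<^sub>C snd a)"
    have "s + ?ca \<in> S"
      using assms(2,3) s a linear_relation_add linear_relation_scaleC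
      by (metis add_Pair prod.collapse subsetD)
    then have "0 \<le> \<sigma> * Im (green_form (s + ?ca) (s + ?ca))"
      by (rule semidef)
    moreover have "green_form (s + ?ca) (s + ?ca)
        = green_form s s + c * green_form a s - cnj (c * green_form a s)"
      using \<open>green_form a a = 0\<close> green_form_commute[of s a]
      by (simp only: green_form_add_left green_form_add_right green_form_scaleC_left
          green_form_scaleC_right) simp
    ultimately show ?thesis
      by (simp add: algebra_simps)
  qed
  note bound = this
  define p q where "p = \<sigma> * Im (green_form s s)" and "q = cmod (green_form a s)"
  \<comment> \<open>The phase of \<open>c\<close> is chosen such that the term linear in \<open>c\<close> contributes a negative multiple of \<open>t\<close>.\<close>
  have "0 \<le> p - 2 * t * \<sigma>\<^sup>2 * q\<^sup>2" for t :: real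
  proof -
    define c where "c = complex_of_real (- t * \<sigma>) * \<i> * cnj (green_form a s)"
    have "cnj (green_form a s) * green_form a s = complex_of_real (q\<^sup>2)"
      unfolding q_def complex_norm_square by (rule mult.commute)
    then have "c * green_form a s = complex_of_real (- t * \<sigma>) * \<i> * complex_of_real (q\<^sup>2)"
      unfolding c_def mult.assoc by (simp only:)
    then have "Im (c * green_form a s) = - t * \<sigma> * q\<^sup>2"
      by simp
    then have "0 \<le> \<sigma> * (Im (green_form s s) + 2 * (- t * \<sigma> * q\<^sup>2))"
      using bound[of c] by (simp only:)
    then show ?thesis
      by (simp add: p_def power2_eq_square algebra_simps)
  qed
  from this[of "(p + 1) / (2 * \<sigma>\<^sup>2 * q\<^sup>2)"] have "q = 0"
    using \<open>\<sigma> \<noteq> 0\<close> by (cases "q = 0") simp_all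
  then show "green_form a s = 0"
    by (simp add: q_def)
qed

section \<open>Boundary maps\<close>

text \<open>
  An ordinary boundary triple: the components of \<open>\<Phi>\<close>, regarded as a map on the graph of the
  adjoint, are the two boundary mappings.
\<close>

locale ordinary_boundary_triple =
  fixes A :: "('h::chilbert_space \<times> 'h) set" and \<Phi> :: "'h \<times> 'h \<Rightarrow> 'g::chilbert_space \<times> 'g"
  assumes linear_A: "linear_relation A" and closed_A: "closed A" and symmetric_A: "rel_symmetric A"
    and green: "\<lbrakk>b \<in> rel_adjoint A; c \<in> rel_adjoint A\<rbrakk> \<Longrightarrow>
      green_form b c = green_form (\<Phi> b) (\<Phi> c)"
    and onto: "\<exists>b\<in>rel_adjoint A. \<Phi> b = z"
begin

definition pull :: "('g \<times> 'g) set \<Rightarrow> ('h \<times> 'h) set" where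
  "pull \<Theta> = {b \<in> rel_adjoint A. \<Phi> b \<in> \<Theta>}"

text \<open>
  Since the form is nondegenerate and \<open>\<Phi>\<close> is onto, identities between values of \<open>\<Phi>\<close> can be tested
  against the values of \<open>\<Phi>\<close>; this gives linearity for free.
\<close>

lemma boundary_eqI:
  assumes "\<And>c. c \<in> rel_adjoint A \<Longrightarrow> green_form z (\<Phi> c) = green_form z' (\<Phi> c)"
  shows "z = z'"
proof -
  have "green_form (z - z') w = 0" for w
    using onto[of w] assms by (auto simp: green_form_diff_left)
  then show ?thesis
    using green_form_nondegenerate by (metis eq_iff_diff_eq_0)
qed

lemma \<Phi>_add:
  assumes "b \<in> rel_adjoint A" "c \<in> rel_adjoint A"
  shows "\<Phi> (b + c) = \<Phi> b + \<Phi> c"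
proof -
  have "b + c \<in> rel_adjoint A"
    using linear_relation_add[OF linear_relation_rel_adjoint] assms
    by (metis add_Pair prod.collapse)
  then show ?thesis
    using assms by (intro boundary_eqI) (simp add: green_form_add_left flip: green)
qed

lemma \<Phi>_scaleC:
  assumes "b \<in> rel_adjoint A"
  shows "\<Phi> (c *\<^sub>C fst b, c *\<^sub>C snd b) = (c *\<^sub>C fst (\<Phi> b), c *\<^sub>C snd (\<Phi> b))"
proof -
  have "(c *\<^sub>C fst b, c *\<^sub>C snd b) \<in> rel_adjoint A"
    using linear_relation_scaleC[OF linear_relation_rel_adjoint] assms by (metis prod.collapse)
  then show ?thesis
    using assms by (intro boundary_eqI) (simp add: green_form_scaleC_left flip: green)
qed

lemma \<Phi>_0: "\<Phi> 0 = 0"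
proof -
  have "0 \<in> rel_adjoint A"
    using linear_relation_zero[OF linear_relation_rel_adjoint] by (simp add: zero_prod_def)
  then show ?thesis
    using \<Phi>_add[of 0 0] by simp
qed

lemma \<Phi>_eq_0:
  assumes "a \<in> A"
  shows "\<Phi> a = 0"
proof (rule boundary_eqI)
  fix c
  assume c: "c \<in> rel_adjoint A"
  have "a \<in> rel_adjoint A"
    using symmetric_A assms by (auto simp only: rel_symmetric_def)
  then have "green_form (\<Phi> a) (\<Phi> c) = green_form a c"
    using c by (simp only: green)
  also have "\<dots> = 0"
    using c assms by (simp only: mem_rel_adjoint_iff)
  finally show "green_form (\<Phi> a) (\<Phi> c) = green_form 0 (\<Phi> c)"
    by (simp add: green_form_def)
qed

lemma pull_subset: "pull \<Theta> \<subseteq> rel_adjoint A"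
  by (auto simp: pull_def)

lemma pull_mono_iff: "pull \<Theta> \<subseteq> pull \<Theta>' \<longleftrightarrow> \<Theta> \<subseteq> \<Theta>'"
proof
  assume sub: "pull \<Theta> \<subseteq> pull \<Theta>'"
  show "\<Theta> \<subseteq> \<Theta>'"
  proof
    fix z
    assume "z \<in> \<Theta>"
    moreover obtain b where "b \<in> rel_adjoint A" "\<Phi> b = z"
      using onto by blast
    ultimately show "z \<in> \<Theta>'"
      using sub by (auto simp: pull_def)
  qed
qed (auto simp: pull_def)

lemma pull_eq_iff: "pull \<Theta> = pull \<Theta>' \<longleftrightarrow> \<Theta> = \<Theta>'"
  unfolding set_eq_subset pull_mono_iff ..

lemma A_subset_pull:
  assumes "linear_relation \<Theta>"
  shows "A \<subseteq> pull \<Theta>"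
proof
  fix a
  assume "a \<in> A"
  moreover from this have "\<Phi> a \<in> \<Theta>"
    using linear_relation_zero[OF assms] by (simp add: \<Phi>_eq_0 zero_prod_def)
  ultimately show "a \<in> pull \<Theta>"
    using symmetric_A by (auto simp only: pull_def rel_symmetric_def)
qed

lemma linear_relation_pull:
  assumes "linear_relation \<Theta>"
  shows "linear_relation (pull \<Theta>)"
proof (rule linear_relationI)
  show "(0, 0) \<in> pull \<Theta>"
    using A_subset_pull[OF assms] linear_relation_zero[OF linear_A] by blast
  show "(x + y, x' + y') \<in> pull \<Theta>"
    if "(x, x') \<in> pull \<Theta>" "(y, y') \<in> pull \<Theta>" for x x' y y'
  proof -
    have xy: "(x, x') \<in> rel_adjoint A" "(y, y') \<in> rel_adjoint A"
      "\<Phi> (x, x') \<in> \<Theta>" "\<Phi> (y, y') \<in> \<Theta>"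
      using that by (simp_all only: pull_def mem_Collect_eq)
    have "\<Phi> (x + y, x' + y') \<in> \<Theta>"
      using \<Phi>_add[OF xy(1,2)] linear_relation_add[OF assms] xy(3,4)
      by (metis add_Pair prod.collapse)
    then show ?thesis
      using linear_relation_add[OF linear_relation_rel_adjoint xy(1,2)] by (simp add: pull_def)
  qed
  show "(c *\<^sub>C x, c *\<^sub>C x') \<in> pull \<Theta>" if "(x, x') \<in> pull \<Theta>" for c x x'
  proof -
    have x: "(x, x') \<in> rel_adjoint A" "\<Phi> (x, x') \<in> \<Theta>"
      using that by (simp_all only: pull_def mem_Collect_eq)
    have "\<Phi> (c *\<^sub>C x, c *\<^sub>C x') \<in> \<Theta>"
      using \<Phi>_scaleC[OF x(1), of c] linear_relation_scaleC[OF assms] x(2)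
      by (metis fst_conv prod.collapse snd_conv)
    then show ?thesis
      using linear_relation_scaleC[OF linear_relation_rel_adjoint x(1)] by (simp add: pull_def)
  qed
qed

text \<open>
  A pair that is orthogonal to the preimage is orthogonal to \<open>A\<close> and hence in the domain of \<open>\<Phi>\<close>,
  where Green's identity applies.
\<close>

lemma rel_adjoint_pull:
  assumes "linear_relation \<Theta>"
  shows "rel_adjoint (pull \<Theta>) = pull (rel_adjoint \<Theta>)"
proof (intro equalityI subsetI)
  fix c
  assume c: "c \<in> rel_adjoint (pull \<Theta>)"
  then have "c \<in> rel_adjoint A"
    using A_subset_pull[OF assms] by (auto simp: mem_rel_adjoint_iff)
  moreover have "green_form z (\<Phi> c) = 0" if "z \<in> \<Theta>" for z
    using onto[of z] that c green[OF _ \<open>c \<in> rel_adjoint A\<close>]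
    by (auto simp: mem_rel_adjoint_iff pull_def)
  ultimately show "c \<in> pull (rel_adjoint \<Theta>)"
    by (simp add: pull_def mem_rel_adjoint_iff[of "\<Phi> c"])
next
  fix c
  assume "c \<in> pull (rel_adjoint \<Theta>)"
  then show "c \<in> rel_adjoint (pull \<Theta>)"
    unfolding pull_def mem_rel_adjoint_iff[of _ "{b \<in> rel_adjoint A. \<Phi> b \<in> \<Theta>}"]
    using green[of _ c] by (auto simp: mem_rel_adjoint_iff[of "\<Phi> c"])
qed

text \<open>A pair in the kernel of \<open>\<Phi>\<close> is in the second adjoint of \<open>A\<close>, which is \<open>A\<close>.\<close>

lemma mem_if_\<Phi>_eq_0:
  assumes "b \<in> rel_adjoint A" "\<Phi> b = 0"
  shows "b \<in> A"
proof -
  have "green_form c b = 0" if "c \<in> rel_adjoint A" for c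
    using green[OF that assms(1)] assms(2) by (simp add: green_form_def)
  then have "b \<in> rel_adjoint (rel_adjoint A)"
    by (simp add: mem_rel_adjoint_iff[of b])
  then show ?thesis
    by (simp add: rel_adjoint_rel_adjoint[OF linear_A closed_A])
qed

lemma pull_image:
  assumes "linear_relation B" "A \<subseteq> B" "B \<subseteq> rel_adjoint A"
  shows "pull (\<Phi> ` B) = B"
proof (intro equalityI subsetI)
  fix b
  assume "b \<in> pull (\<Phi> ` B)"
  then obtain c where b: "b \<in> rel_adjoint A" and c: "c \<in> B" "\<Phi> b = \<Phi> c"
    by (auto simp: pull_def)
  have "c \<in> rel_adjoint A"
    using c assms(3) by blast
  have diff: "b - c \<in> rel_adjoint A"
    using linear_relation_diff[OF linear_relation_rel_adjoint] b \<open>c \<in> rel_adjoint A\<close>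
    by (metis diff_Pair prod.collapse)
  have "\<Phi> (b - c) = 0"
    using \<Phi>_add[OF diff \<open>c \<in> rel_adjoint A\<close>] c(2) by simp
  then have "b - c \<in> B"
    using mem_if_\<Phi>_eq_0[OF diff] assms(2) by blast
  then have "(b - c) + c \<in> B"
    using linear_relation_add[OF assms(1)] c(1) by (metis add_Pair prod.collapse)
  then show "b \<in> B"
    by simp
qed (use assms(3) in \<open>auto simp: pull_def\<close>)

lemma linear_relation_image:
  assumes "linear_relation B" "B \<subseteq> rel_adjoint A"
  shows "linear_relation (\<Phi> ` B)"
proof -
  have "(x + y, x' + y') \<in> \<Phi> ` B" if "(x, x') \<in> \<Phi> ` B" "(y, y') \<in> \<Phi> ` B" for x x' y y'
  proof -
    from that obtain b c where bc: "b \<in> B" "(x, x') = \<Phi> b" "c \<in> B" "(y, y') = \<Phi> c"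
      by blast
    then have "b + c \<in> B"
      using linear_relation_add[OF assms(1)] by (metis add_Pair prod.collapse)
    moreover have "\<Phi> (b + c) = (x + y, x' + y')"
      using \<Phi>_add[of b c] bc assms(2) by (metis add_Pair subsetD)
    ultimately show ?thesis
      by (metis image_eqI)
  qed
  moreover have "(c *\<^sub>C x, c *\<^sub>C x') \<in> \<Phi> ` B" if "(x, x') \<in> \<Phi> ` B" for x x' c
  proof -
    from that obtain b where b: "b \<in> B" "(x, x') = \<Phi> b"
      by blast
    then have "(c *\<^sub>C fst b, c *\<^sub>C snd b) \<in> B"
      using linear_relation_scaleC[OF assms(1)] by (metis prod.collapse)
    moreover have "\<Phi> (c *\<^sub>C fst b, c *\<^sub>C snd b) = (c *\<^sub>C x, c *\<^sub>C x')"
      using \<Phi>_scaleC[of b c] b assms(2) by (metis fst_conv snd_conv subsetD)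
    ultimately show ?thesis
      by (metis image_eqI)
  qed
  moreover have "(0, 0) \<in> \<Phi> ` B"
    using \<Phi>_0 linear_relation_zero[OF assms(1)] by (metis image_eqI zero_prod_def)
  ultimately show ?thesis
    by (intro linear_relationI)
qed

lemma bij_betw_pull:
  "bij_betw pull {\<Theta>. linear_relation \<Theta> \<and> Domain \<Theta> \<subseteq> D}
     {B. linear_relation B \<and> A \<subseteq> B \<and> B \<subseteq> pull (D \<times> UNIV)}"
proof (intro bij_betwI[where g = "(`) \<Phi>"])
  show "pull \<in> {\<Theta>. linear_relation \<Theta> \<and> Domain \<Theta> \<subseteq> D}
      \<rightarrow> {B. linear_relation B \<and> A \<subseteq> B \<and> B \<subseteq> pull (D \<times> UNIV)}"
  proof (clarsimp simp only: Pi_iff mem_Collect_eq pull_mono_iff)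
    fix \<Theta> :: "('g \<times> 'g) set"
    assume "linear_relation \<Theta>" "Domain \<Theta> \<subseteq> D"
    then show "linear_relation (pull \<Theta>) \<and> A \<subseteq> pull \<Theta> \<and> \<Theta> \<subseteq> D \<times> UNIV"
      by (auto intro: linear_relation_pull dest: subsetD[OF A_subset_pull] simp del: split_paired_All)
  qed
  show "(`) \<Phi> \<in> {B. linear_relation B \<and> A \<subseteq> B \<and> B \<subseteq> pull (D \<times> UNIV)}
      \<rightarrow> {\<Theta>. linear_relation \<Theta> \<and> Domain \<Theta> \<subseteq> D}"
  proof clarsimp
    fix B
    assume B: "linear_relation B" "B \<subseteq> pull (D \<times> UNIV)"
    have "\<Phi> ` B \<subseteq> D \<times> UNIV"
      using B(2) by (auto simp: pull_def)
    then have "Domain (\<Phi> ` B) \<subseteq> D"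
      by (auto simp del: split_paired_All)
    moreover have "linear_relation (\<Phi> ` B)"
      using B(2) pull_subset by (intro linear_relation_image[OF B(1)]) (rule order_trans)
    ultimately show "linear_relation (\<Phi> ` B) \<and> Domain (\<Phi> ` B) \<subseteq> D"
      by blast
  qed
  show "\<Phi> ` pull \<Theta> = \<Theta>" for \<Theta>
  proof (intro equalityI subsetI)
    fix z
    assume "z \<in> \<Theta>"
    moreover obtain b where "b \<in> rel_adjoint A" "\<Phi> b = z"
      using onto by blast
    ultimately show "z \<in> \<Phi> ` pull \<Theta>"
      by (auto simp: pull_def)
  qed (auto simp: pull_def)
  show "pull (\<Phi> ` B) = B"
    if B: "B \<in> {B. linear_relation B \<and> A \<subseteq> B \<and> B \<subseteq> pull (D \<times> UNIV)}" for B
  proof (rule pull_image)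
    have "B \<subseteq> pull (D \<times> UNIV)"
      using B by simp
    then show "B \<subseteq> rel_adjoint A"
      by (rule order_trans[OF _ pull_subset])
  qed (use B in simp_all)
qed

lemma closed_pull_iff:
  assumes "linear_relation \<Theta>"
  shows "closed (pull \<Theta>) \<longleftrightarrow> closed \<Theta>"
proof -
  have "closed (pull \<Theta>) \<longleftrightarrow> rel_adjoint (rel_adjoint (pull \<Theta>)) = pull \<Theta>"
    by (rule closed_iff_rel_adjoint_rel_adjoint[OF linear_relation_pull[OF assms]])
  also have "\<dots> \<longleftrightarrow> rel_adjoint (rel_adjoint \<Theta>) = \<Theta>"
    unfolding rel_adjoint_pull[OF assms] rel_adjoint_pull[OF linear_relation_rel_adjoint]
    by (rule pull_eq_iff)
  also have "\<dots> \<longleftrightarrow> closed \<Theta>"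
    by (rule closed_iff_rel_adjoint_rel_adjoint[OF assms, symmetric])
  finally show ?thesis .
qed

lemma rel_symmetric_pull_iff:
  "linear_relation \<Theta> \<Longrightarrow> rel_symmetric (pull \<Theta>) \<longleftrightarrow> rel_symmetric \<Theta>"
  unfolding rel_symmetric_def by (simp only: rel_adjoint_pull pull_mono_iff)

lemma rel_selfadjoint_pull_iff:
  "linear_relation \<Theta> \<Longrightarrow> rel_selfadjoint (pull \<Theta>) \<longleftrightarrow> rel_selfadjoint \<Theta>"
  unfolding rel_selfadjoint_def by (simp only: rel_adjoint_pull pull_eq_iff)

lemma semidefinite_pull_iff:
  "(\<forall>b\<in>pull \<Theta>. Q (green_form b b)) \<longleftrightarrow> (\<forall>z\<in>\<Theta>. Q (green_form z z))"
proof
  assume sd: "\<forall>b\<in>pull \<Theta>. Q (green_form b b)"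
  show "\<forall>z\<in>\<Theta>. Q (green_form z z)"
  proof
    fix z
    assume "z \<in> \<Theta>"
    moreover obtain b where "b \<in> rel_adjoint A" "\<Phi> b = z"
      using onto by blast
    ultimately show "Q (green_form z z)"
      using sd green[of b b] by (auto simp: pull_def simp del: split_paired_All)
  qed
next
  assume "\<forall>z\<in>\<Theta>. Q (green_form z z)"
  then show "\<forall>b\<in>pull \<Theta>. Q (green_form b b)"
    by (auto simp: pull_def green)
qed

lemma dissipative_pull_iff: "dissipative (pull \<Theta>) \<longleftrightarrow> dissipative \<Theta>"
  unfolding dissipative_iff by (rule semidefinite_pull_iff)

lemma accumulative_pull_iff: "accumulative (pull \<Theta>) \<longleftrightarrow> accumulative \<Theta>"
  unfolding accumulative_iff by (rule semidefinite_pull_iff)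

text \<open>
  The competitors of the preimage in the definition of maximality extend \<open>A\<close>. When \<open>P\<close> forces them
  into the adjoint, they are themselves preimages; conversely a preimage is an operator because the
  adjoint of a densely defined operator is one.
\<close>

lemma maximal_with_pull_iff:
  fixes P :: "('h \<times> 'h) set \<Rightarrow> bool" and P' :: "('g \<times> 'g) set \<Rightarrow> bool"
  assumes dense: "closure (Domain A) = UNIV" and \<Theta>: "linear_relation \<Theta>"
    and P: "\<And>\<Theta>. P (pull \<Theta>) \<longleftrightarrow> P' \<Theta>"
    and ext: "\<And>S. \<lbrakk>A \<subseteq> S; linear_relation S; P S\<rbrakk> \<Longrightarrow> S \<subseteq> rel_adjoint A"
  shows "maximal_with linear_operator P (pull \<Theta>) \<longleftrightarrow> maximal_with linear_relation P' \<Theta>"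
proof -
  have operator: "linear_operator (pull \<Theta>')" if "linear_relation \<Theta>'" for \<Theta>'
    using linear_relation_pull[OF that] single_valued_rel_adjoint[OF dense] pull_subset
    unfolding linear_operator_def by (meson single_valued_subset)
  show ?thesis
  proof
    assume max: "maximal_with linear_operator P (pull \<Theta>)"
    show "maximal_with linear_relation P' \<Theta>"
      unfolding maximal_with_def
    proof (intro conjI allI impI \<Theta>)
      show "P' \<Theta>"
        using max P by (simp add: maximal_with_def)
      fix \<Theta>'
      assume "linear_relation \<Theta>' \<and> P' \<Theta>' \<and> \<Theta> \<subseteq> \<Theta>'"
      then have "pull \<Theta>' = pull \<Theta>"
        using max operator P pull_mono_iff unfolding maximal_with_def by blast
      then show "\<Theta>' = \<Theta>"
        by (simp add: pull_eq_iff)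
    qed
  next
    assume max: "maximal_with linear_relation P' \<Theta>"
    show "maximal_with linear_operator P (pull \<Theta>)"
      unfolding maximal_with_def
    proof (intro conjI allI impI operator \<Theta>)
      show "P (pull \<Theta>)"
        using max P by (simp add: maximal_with_def)
      fix S
      assume S: "linear_operator S \<and> P S \<and> pull \<Theta> \<subseteq> S"
      then have "linear_relation S" "A \<subseteq> S"
        using A_subset_pull[OF \<Theta>] by (auto simp: linear_operator_def)
      then have S_adj: "S \<subseteq> rel_adjoint A"
        using ext S by blast
      have pull_S: "pull (\<Phi> ` S) = S"
        by (rule pull_image) fact+
      then have "P' (\<Phi> ` S)" "\<Theta> \<subseteq> \<Phi> ` S"
        using S P pull_mono_iff by metis+
      then have "\<Phi> ` S = \<Theta>"
        using max linear_relation_image[OF \<open>linear_relation S\<close> S_adj]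
        unfolding maximal_with_def by blast
      then show "S = pull \<Theta>"
        using pull_S by simp
    qed
  qed
qed

lemma maximal_dissipative_pull_iff:
  assumes "closure (Domain A) = UNIV" "linear_relation \<Theta>"
  shows "maximal_with linear_operator dissipative (pull \<Theta>)
    \<longleftrightarrow> maximal_with linear_relation dissipative \<Theta>"
  using semidefinite_extension_subset_rel_adjoint[OF symmetric_A, where \<sigma> = 1]
  by (intro maximal_with_pull_iff assms dissipative_pull_iff) (simp add: dissipative_iff)

lemma maximal_accumulative_pull_iff:
  assumes "closure (Domain A) = UNIV" "linear_relation \<Theta>"
  shows "maximal_with linear_operator accumulative (pull \<Theta>)
    \<longleftrightarrow> maximal_with linear_relation accumulative \<Theta>"
  using semidefinite_extension_subset_rel_adjoint[OF symmetric_A, where \<sigma> = "- 1"]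
  by (intro maximal_with_pull_iff assms accumulative_pull_iff) (simp add: accumulative_iff)

end

section \<open>The boundary triple of a quasi boundary triple\<close>

text \<open>
  The context of a quasi boundary triple together with the maps \<open>\<iota>\<^sub>p\<close> and \<open>\<iota>\<^sub>m\<close> that transform its
  boundary mappings into those of an ordinary boundary triple.
\<close>

locale transformed_qbt =
  fixes A T :: "('h::chilbert_space \<times> 'h) set"
    and \<Gamma>\<^sub>0 \<Gamma>\<^sub>1 :: "'h \<Rightarrow> 'g::chilbert_space"
    and n :: "'g \<Rightarrow> real"
    and \<iota>\<^sub>p :: "'g \<Rightarrow> 'g"
    and \<iota>\<^sub>m :: "('g \<Rightarrow> complex) \<Rightarrow> 'g"
    and \<eta> :: real
  assumes linear_A: "linear_operator A" and closed_A: "closed A"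
    and symmetric_A: "rel_symmetric A"
    and qbt: "quasi_boundary_triple A T \<Gamma>\<^sub>0 \<Gamma>\<^sub>1"
    and \<eta>: "complex_of_real \<eta> \<in> resolvent_set (A0 T \<Gamma>\<^sub>0)"
    and norm: "admissible_norm T \<Gamma>\<^sub>0 \<Gamma>\<^sub>1 n"
    and iota: "iota_pair (G1 T \<Gamma>\<^sub>0 \<Gamma>\<^sub>1) n \<iota>\<^sub>p \<iota>\<^sub>m"
begin

abbreviation "S \<equiv> G1 T \<Gamma>\<^sub>0 \<Gamma>\<^sub>1"

abbreviation \<eta>\<^sub>c :: complex where "\<eta>\<^sub>c \<equiv> complex_of_real \<eta>"

lemma linear_T: "linear_relation T"
  and single_valued_T: "single_valued T"
  and T_subset: "T \<subseteq> rel_adjoint A"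
  and closure_T: "closure T = rel_adjoint A"
  and selfadjoint_A0: "rel_adjoint (A0 T \<Gamma>\<^sub>0) = A0 T \<Gamma>\<^sub>0"
  and dense_range: "closure ((\<lambda>f. (\<Gamma>\<^sub>0 f, \<Gamma>\<^sub>1 f)) ` Domain T) = UNIV"
  using qbt by (auto simp: quasi_boundary_triple_def linear_operator_def rel_selfadjoint_def)

lemma trace_linear:
  assumes "(f, f') \<in> T" "(g, g') \<in> T"
  shows "\<Gamma>\<^sub>0 (f + g) = \<Gamma>\<^sub>0 f + \<Gamma>\<^sub>0 g" "\<Gamma>\<^sub>1 (f + g) = \<Gamma>\<^sub>1 f + \<Gamma>\<^sub>1 g"
    "\<Gamma>\<^sub>0 (c *\<^sub>C f) = c *\<^sub>C \<Gamma>\<^sub>0 f" "\<Gamma>\<^sub>1 (c *\<^sub>C f) = c *\<^sub>C \<Gamma>\<^sub>1 f"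
  using qbt assms DomainI[OF assms(1)] DomainI[OF assms(2)]
  by (simp_all add: quasi_boundary_triple_def clinear_on_def)

lemma trace_diff:
  assumes "(f, f') \<in> T" "(g, g') \<in> T"
  shows "\<Gamma>\<^sub>0 (f - g) = \<Gamma>\<^sub>0 f - \<Gamma>\<^sub>0 g" "\<Gamma>\<^sub>1 (f - g) = \<Gamma>\<^sub>1 f - \<Gamma>\<^sub>1 g"
  using trace_linear(1,2)[OF linear_relation_diff[OF linear_T assms] assms(2)] by simp_all

lemma green_T:
  assumes "(f, f') \<in> T" "(g, g') \<in> T"
  shows "cinner f' g - cinner f g' = cinner (\<Gamma>\<^sub>1 f) (\<Gamma>\<^sub>0 g) - cinner (\<Gamma>\<^sub>0 f) (\<Gamma>\<^sub>1 g)"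
  using qbt assms by (fastforce simp: quasi_boundary_triple_def)

text \<open>
  \<open>A\<close> lies in \<open>A\<^sub>0\<close> because it is orthogonal to \<open>A\<^sub>0\<close> for the form and \<open>A\<^sub>0\<close> is self-adjoint; then Green's identity
  makes \<open>\<Gamma>\<^sub>1\<close> on its domain orthogonal to the dense range of \<open>\<Gamma>\<^sub>0\<close>.
\<close>

lemma A_subset_minimal:
  assumes "(g, g') \<in> A"
  shows "(g, g') \<in> T" "\<Gamma>\<^sub>0 g = 0" "\<Gamma>\<^sub>1 g = 0"
proof -
  have "green_form b (g, g') = 0" if "b \<in> T" for b
    using that T_subset assms green_form_commute[of b "(g, g')"]
    by (auto simp: mem_rel_adjoint_iff)
  then have "(g, g') \<in> rel_adjoint (A0 T \<Gamma>\<^sub>0)"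
    by (auto simp: mem_rel_adjoint_iff A0_def)
  then have "(g, g') \<in> A0 T \<Gamma>\<^sub>0"
    by (simp only: selfadjoint_A0)
  then show g: "(g, g') \<in> T" "\<Gamma>\<^sub>0 g = 0"
    by (auto simp: A0_def)
  have "cinner (\<Gamma>\<^sub>1 g) (fst z) = 0" if "z \<in> (\<lambda>f. (\<Gamma>\<^sub>0 f, \<Gamma>\<^sub>1 f)) ` Domain T" for z
  proof -
    obtain f f' where f: "(f, f') \<in> T" "z = (\<Gamma>\<^sub>0 f, \<Gamma>\<^sub>1 f)"
      using \<open>z \<in> _\<close> by blast
    have "green_form (g, g') (f, f') = 0"
      using f(1) T_subset assms by (auto simp: mem_rel_adjoint_iff)
    then show ?thesis
      using green_T[OF g(1) f(1)] g(2) f(2) by (simp add: green_form_def)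
  qed
  note zero = this
  have "cinner (\<Gamma>\<^sub>1 g) (fst z) = 0"
    if "z \<in> closure ((\<lambda>f. (\<Gamma>\<^sub>0 f, \<Gamma>\<^sub>1 f)) ` Domain T)" for z
    by (rule continuous_constant_on_closure[OF _ zero that]) (intro continuous_intros)
  from this[of "(\<Gamma>\<^sub>1 g, 0)"] show "\<Gamma>\<^sub>1 g = 0"
    by (simp add: dense_range)
qed

text \<open>The everywhere defined operator \<open>(A\<^sub>0 - \<eta>)\<^sup>-\<^sup>1\<close>.\<close>

definition R :: "'h \<Rightarrow> 'h" where
  "R h = (THE f. (h, f) \<in> resolvent (A0 T \<Gamma>\<^sub>0) \<eta>\<^sub>c)"

lemma mem_resolvent_iff: "(h, f) \<in> resolvent (A0 T \<Gamma>\<^sub>0) \<eta>\<^sub>c \<longleftrightarrow> f = R h"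
proof -
  have "\<exists>!f. (h, f) \<in> resolvent (A0 T \<Gamma>\<^sub>0) \<eta>\<^sub>c"
    using \<eta> by (auto simp: resolvent_set_def single_valued_def Domain_iff set_eq_iff)
  then show ?thesis
    unfolding R_def by (metis theI')
qed

lemma R_eqI: "\<lbrakk>(f, f') \<in> T; \<Gamma>\<^sub>0 f = 0\<rbrakk> \<Longrightarrow> R (f' - \<eta>\<^sub>c *\<^sub>C f) = f"
  using mem_resolvent_iff[of "f' - \<eta>\<^sub>c *\<^sub>C f" f] by (auto simp: resolvent_def A0_def)

lemma R_in_T: "(R h, h + \<eta>\<^sub>c *\<^sub>C R h) \<in> T" and trace_R: "\<Gamma>\<^sub>0 (R h) = 0"
proof -
  obtain f' where f': "h = f' - \<eta>\<^sub>c *\<^sub>C R h" "(R h, f') \<in> T" "\<Gamma>\<^sub>0 (R h) = 0"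
    using mem_resolvent_iff[of h "R h"] by (auto simp: resolvent_def A0_def)
  then show "\<Gamma>\<^sub>0 (R h) = 0"
    by blast
  have "f' = h + \<eta>\<^sub>c *\<^sub>C R h"
    by (subst f'(1)) simp
  then show "(R h, h + \<eta>\<^sub>c *\<^sub>C R h) \<in> T"
    using f'(2) by simp
qed

lemma R_add: "R (h + k) = R h + R k"
proof -
  have "(R h + R k, (h + \<eta>\<^sub>c *\<^sub>C R h) + (k + \<eta>\<^sub>c *\<^sub>C R k)) \<in> T"
    by (intro linear_relation_add linear_T R_in_T)
  moreover have "\<Gamma>\<^sub>0 (R h + R k) = 0"
    by (simp add: trace_linear(1)[OF R_in_T R_in_T] trace_R)
  ultimately have "R ((h + \<eta>\<^sub>c *\<^sub>C R h) + (k + \<eta>\<^sub>c *\<^sub>C R k) - \<eta>\<^sub>c *\<^sub>C (R h + R k)) = R h + R k"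
    by (rule R_eqI)
  then show ?thesis
    by (simp add: scaleC_add_right algebra_simps)
qed

lemma R_scaleC: "R (c *\<^sub>C h) = c *\<^sub>C R h"
proof -
  have "(c *\<^sub>C R h, c *\<^sub>C (h + \<eta>\<^sub>c *\<^sub>C R h)) \<in> T"
    by (intro linear_relation_scaleC linear_T R_in_T)
  moreover have "\<Gamma>\<^sub>0 (c *\<^sub>C R h) = 0"
    by (simp add: trace_linear(3)[OF R_in_T R_in_T] trace_R)
  ultimately have "R (c *\<^sub>C (h + \<eta>\<^sub>c *\<^sub>C R h) - \<eta>\<^sub>c *\<^sub>C (c *\<^sub>C R h)) = c *\<^sub>C R h"
    by (rule R_eqI)
  then show ?thesis
    by (simp add: scaleC_add_right scaleC_scaleC mult.commute)
qed

lemma R_bounded: "\<exists>K. \<forall>h. norm (R h) \<le> K * norm h"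
proof -
  obtain K where "\<forall>(g, f)\<in>resolvent (A0 T \<Gamma>\<^sub>0) \<eta>\<^sub>c. norm f \<le> K * norm g"
    using \<eta> by (auto simp: resolvent_set_def)
  then show ?thesis
    using mem_resolvent_iff by blast
qed

lemma R_symmetric: "cinner (R k) h = cinner k (R h)"
  using green_T[OF R_in_T[of k] R_in_T[of h]]
  by (simp add: trace_R cinner_add_left cinner_add_right cinner_scaleC_left cinner_scaleC_right)

lemma trace_R_in_G1: "\<Gamma>\<^sub>1 (R h) \<in> S"
  using R_in_T[of h] trace_R[of h] by (auto simp: G1_def)

lemma G1_eq_range: "S = range (\<lambda>h. \<Gamma>\<^sub>1 (R h))"
proof (intro equalityI subsetI)
  fix x
  assume "x \<in> S"
  then obtain f f' where "(f, f') \<in> T" "\<Gamma>\<^sub>0 f = 0" "x = \<Gamma>\<^sub>1 f"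
    by (auto simp: G1_def)
  then show "x \<in> range (\<lambda>h. \<Gamma>\<^sub>1 (R h))"
    using R_eqI[of f f'] by (metis rangeI)
qed (use trace_R_in_G1 in auto)

lemma G1_add: "\<lbrakk>x \<in> S; y \<in> S\<rbrakk> \<Longrightarrow> x + y \<in> S"
  unfolding G1_eq_range using trace_linear(2)[OF R_in_T R_in_T] R_add
  by clarify (metis rangeI)

lemma G1_scaleC: "x \<in> S \<Longrightarrow> c *\<^sub>C x \<in> S"
  unfolding G1_eq_range using trace_linear(4)[OF R_in_T R_in_T] R_scaleC
  by clarify (metis rangeI)

definition P :: "'h \<Rightarrow> 'g" where
  "P h = \<iota>\<^sub>p (\<Gamma>\<^sub>1 (R h))"

lemma P_add: "P (h + k) = P h + P k"
  using iota trace_R_in_G1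
  by (simp add: P_def R_add trace_linear(2)[OF R_in_T R_in_T] iota_pair_def clinear_on_def)

lemma P_scaleC: "P (c *\<^sub>C h) = c *\<^sub>C P h"
  using iota trace_R_in_G1
  by (simp add: P_def R_scaleC trace_linear(4)[OF R_in_T R_in_T] iota_pair_def clinear_on_def)

lemma surj_P: "surj P"
proof -
  have "range P = \<iota>\<^sub>p ` S"
    unfolding G1_eq_range P_def by auto
  then show ?thesis
    using iota by (simp add: iota_pair_def bij_betw_def)
qed

text \<open>
  The boundedness of \<open>\<Gamma>\<^sub>1 (A\<^sub>0 - \<lambda>)\<^sup>-\<^sup>1\<close> carries over from one point of the resolvent set to \<open>\<eta>\<close> by
  the resolvent identity.
\<close>

lemma P_bounded: "\<exists>K. \<forall>h. norm (P h) \<le> norm h * K"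
proof -
  obtain \<mu> K where K: "\<And>g f. (g, f) \<in> resolvent (A0 T \<Gamma>\<^sub>0) (cnj \<mu>) \<Longrightarrow> n (\<Gamma>\<^sub>1 f) \<le> K * norm g"
    using norm by (fastforce simp: admissible_norm_def)
  obtain K' where K': "\<And>h. norm (R h) \<le> K' * norm h"
    using R_bounded by blast
  let ?c = "\<eta>\<^sub>c - cnj \<mu>"
  have "norm (P h) \<le> norm h * (\<bar>K\<bar> * (1 + cmod ?c * K'))" for h
  proof -
    have "\<eta>\<^sub>c *\<^sub>C R h = ?c *\<^sub>C R h + cnj \<mu> *\<^sub>C R h"
      by (simp flip: scaleC_add_left)
    then have "(h + \<eta>\<^sub>c *\<^sub>C R h) - cnj \<mu> *\<^sub>C R h = h + ?c *\<^sub>C R h"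
      by simp
    moreover have "((h + \<eta>\<^sub>c *\<^sub>C R h) - cnj \<mu> *\<^sub>C R h, R h) \<in> resolvent (A0 T \<Gamma>\<^sub>0) (cnj \<mu>)"
      using R_in_T[of h] trace_R[of h] unfolding resolvent_def A0_def by blast
    ultimately have "(h + ?c *\<^sub>C R h, R h) \<in> resolvent (A0 T \<Gamma>\<^sub>0) (cnj \<mu>)"
      by (simp only:)
    then have "n (\<Gamma>\<^sub>1 (R h)) \<le> K * norm (h + ?c *\<^sub>C R h)"
      by (rule K)
    also have "\<dots> \<le> \<bar>K\<bar> * norm (h + ?c *\<^sub>C R h)"
      by (intro mult_right_mono) auto
    also have "norm (h + ?c *\<^sub>C R h) \<le> norm h + cmod ?c * (K' * norm h)"
      using norm_triangle_ineq[of h "?c *\<^sub>C R h"] mult_left_mono[OF K'[of h], of "cmod ?c"]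
      by (simp add: norm_scaleC)
    finally have "n (\<Gamma>\<^sub>1 (R h)) \<le> \<bar>K\<bar> * (norm h + cmod ?c * (K' * norm h))"
      by (simp add: mult_left_mono)
    moreover have "norm (P h) = n (\<Gamma>\<^sub>1 (R h))"
      using iota trace_R_in_G1 by (simp add: P_def iota_pair_def)
    ultimately show ?thesis
      by (simp add: algebra_simps)
  qed
  then show ?thesis
    by blast
qed

lemma cinner_P_eqI:
  assumes "\<And>h. cinner x (P h) = cinner x' (P h)"
  shows "x = x'"
proof -
  obtain h where "P h = x - x'"
    using surj_P by (metis surjD)
  then have "cinner (x - x') (x - x') = 0"
    using assms[of h] by (simp add: cinner_diff_left)
  then show ?thesis
    by simp
qed

abbreviation J :: "'g \<Rightarrow> 'g" where
  "J g \<equiv> \<iota>\<^sub>m (into_antidual S g)"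

lemma into_antidual_in_antidual: "into_antidual S g \<in> antidual S n"
proof -
  obtain K where K: "\<And>x. x \<in> S \<Longrightarrow> norm x \<le> K * n x"
    using norm by (auto simp: admissible_norm_def)
  have "cmod (cinner g x) \<le> (norm g * K) * n x" if "x \<in> S" for x
  proof -
    have "cmod (cinner g x) \<le> norm g * norm x"
      by (rule Cauchy_Schwarz_cinner)
    also have "\<dots> \<le> norm g * (K * n x)"
      using K[OF that] by (simp add: mult_left_mono)
    finally show ?thesis
      by (simp only: mult.assoc)
  qed
  then show ?thesis
    unfolding antidual_def into_antidual_def
    by (auto simp: G1_add G1_scaleC cinner_add_right cinner_scaleC_right)
qed

lemma iota_m_pairing: "\<phi> \<in> antidual S n \<Longrightarrow> cinner (\<iota>\<^sub>m \<phi>) (P h) = \<phi> (\<Gamma>\<^sub>1 (R h))"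
  using iota trace_R_in_G1 by (simp add: iota_pair_def P_def)

text \<open>
  The right-hand side of this equation makes sense for all pairs in the adjoint of \<open>A\<close>, and is the
  definition of the extension of \<open>J \<circ> \<Gamma>\<^sub>0\<close>.
\<close>

lemma cinner_trace_P:
  assumes "(f, f') \<in> T"
  shows "cinner (J (\<Gamma>\<^sub>0 f)) (P h) = cinner f h - cinner (f' - \<eta>\<^sub>c *\<^sub>C f) (R h)"
proof -
  have "cinner (J (\<Gamma>\<^sub>0 f)) (P h) = cinner (\<Gamma>\<^sub>0 f) (\<Gamma>\<^sub>1 (R h))"
    using iota_m_pairing[OF into_antidual_in_antidual] trace_R_in_G1
    by (simp add: into_antidual_def)
  also have "\<dots> = cinner f (h + \<eta>\<^sub>c *\<^sub>C R h) - cinner f' (R h)"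
    using green_T[OF assms R_in_T[of h]] by (simp add: trace_R algebra_simps)
  finally show ?thesis
    by (simp add: cinner_add_right cinner_diff_left cinner_scaleC_left cinner_scaleC_right)
qed

text \<open>
  The functional that \<open>x\<close> has to represent is a pointwise limit of functionals given by traces of
  elements of \<open>T\<close>. Since \<open>P\<close> is onto, the pointwise convergence takes place on the whole space, so
  the limit is bounded; transported to the space \<open>S\<close> by \<open>\<iota>\<^sub>p\<close>, it is an element of the anti-dual
  and is represented by its image under \<open>\<iota>\<^sub>m\<close>.
\<close>

lemma exists_extended_trace:
  assumes "b \<in> rel_adjoint A"
  shows "\<exists>x. \<forall>h. cinner x (P h) = cinner (fst b) h - cinner (snd b - \<eta>\<^sub>c *\<^sub>C fst b) (R h)"
proof -
  obtain B where B: "\<And>k. B k \<in> T" and lim: "B \<longlonglongrightarrow> b"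
    using assms closure_T by (metis closure_sequential)
  define X where "X k = J (\<Gamma>\<^sub>0 (fst (B k)))" for k
  have X: "(\<lambda>k. cinner (X k) (P h)) \<longlonglongrightarrow> cinner (fst b) h - cinner (snd b - \<eta>\<^sub>c *\<^sub>C fst b) (R h)"
    for h
  proof -
    have "cinner (X k) (P h)
        = cinner (fst (B k)) h - cinner (snd (B k) - \<eta>\<^sub>c *\<^sub>C fst (B k)) (R h)" for k
      using cinner_trace_P[of "fst (B k)" "snd (B k)"] B[of k] by (simp add: X_def)
    moreover have "(\<lambda>k. cinner (fst (B k)) h - cinner (snd (B k) - \<eta>\<^sub>c *\<^sub>C fst (B k)) (R h))
        \<longlonglongrightarrow> cinner (fst b) h - cinner (snd b - \<eta>\<^sub>c *\<^sub>C fst b) (R h)"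
      by (intro tendsto_diff tendsto_cinner tendsto_scaleC tendsto_fst tendsto_snd tendsto_const lim)
    ultimately show ?thesis
      by (simp only:)
  qed
  have convergent: "convergent (\<lambda>k. cinner (X k) y)" for y
  proof -
    obtain h where "y = P h"
      using surjD[OF surj_P] by blast
    then show ?thesis
      using X by (auto simp only: convergent_def)
  qed
  have "Bseq (\<lambda>k. inner (X k) y)" for y
  proof -
    obtain C where "\<And>k. cmod (cinner (X k) y) \<le> C"
      using convergent_imp_Bseq[OF convergent] by (auto simp: Bseq_def)
    then show ?thesis
      by (intro BseqI'[of _ C]) (metis Re_cinner abs_Re_le_cmod order_trans real_norm_def)
  qed
  then have "Bseq X"
    by (rule weakly_bounded_imp_Bseq)
  then obtain C where C: "\<And>k. norm (X k) \<le> C"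
    by (auto simp: Bseq_def)
  define \<phi> where "\<phi> y = lim (\<lambda>k. cinner (X k) y)" for y
  have \<phi>: "(\<lambda>k. cinner (X k) y) \<longlonglongrightarrow> \<phi> y" for y
    using convergent[of y] by (simp add: \<phi>_def convergent_LIMSEQ_iff)
  have \<phi>_add: "\<phi> (y + z) = \<phi> y + \<phi> z" for y z
    using tendsto_add[OF \<phi>[of y] \<phi>[of z]] \<phi>[of "y + z"]
    unfolding cinner_add_right by (rule LIMSEQ_unique[symmetric])
  have \<phi>_scaleC: "\<phi> (c *\<^sub>C y) = cnj c * \<phi> y" for c y
    using tendsto_mult[OF tendsto_const \<phi>[of y]] \<phi>[of "c *\<^sub>C y"]
    unfolding cinner_scaleC_right by (rule LIMSEQ_unique[symmetric])
  have \<phi>_bound: "cmod (\<phi> y) \<le> C * norm y" for y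
  proof (rule Lim_norm_ubound[OF _ \<phi>])
    show "\<forall>\<^sub>F k in sequentially. cmod (cinner (X k) y) \<le> C * norm y"
      by (intro always_eventually allI order_trans[OF Cauchy_Schwarz_cinner] mult_right_mono C
          norm_ge_zero)
  qed simp
  define \<psi> where "\<psi> x = (if x \<in> S then \<phi> (\<iota>\<^sub>p x) else 0)" for x
  have "\<psi> \<in> antidual S n"
    unfolding antidual_def mem_Collect_eq
  proof (intro conjI ballI allI impI exI[of _ C])
    show "\<psi> (x + y) = \<psi> x + \<psi> y" if "x \<in> S" "y \<in> S" for x y
      using iota that by (simp add: \<psi>_def iota_pair_def clinear_on_def \<phi>_add G1_add)
    show "\<psi> (c *\<^sub>C x) = cnj c * \<psi> x" if "x \<in> S" for c x
      using iota that by (simp add: \<psi>_def iota_pair_def clinear_on_def \<phi>_scaleC G1_scaleC)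
    show "cmod (\<psi> x) \<le> C * n x" if "x \<in> S" for x
      using iota that \<phi>_bound[of "\<iota>\<^sub>p x"] by (simp add: \<psi>_def iota_pair_def)
  qed (simp add: \<psi>_def)
  then have "cinner (\<iota>\<^sub>m \<psi>) (P h) = \<phi> (P h)" for h
    using iota_m_pairing[of \<psi> h] by (simp add: \<psi>_def trace_R_in_G1 P_def)
  moreover have "\<phi> (P h) = cinner (fst b) h - cinner (snd b - \<eta>\<^sub>c *\<^sub>C fst b) (R h)" for h
    using \<phi> X by (rule LIMSEQ_unique)
  ultimately show ?thesis
    by auto
qed

text \<open>
  The description of the first component is meaningful only on the adjoint of \<open>A\<close>, where the
  required element exists; it is unique because \<open>P\<close> is onto.
\<close>

definition \<Phi> :: "'h \<times> 'h \<Rightarrow> 'g \<times> 'g" where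
  "\<Phi> b = (THE x. \<forall>h. cinner x (P h) = cinner (fst b) h - cinner (snd b - \<eta>\<^sub>c *\<^sub>C fst b) (R h),
          P (snd b - \<eta>\<^sub>c *\<^sub>C fst b))"

lemma fst_\<Phi>_eqI:
  assumes "\<And>h. cinner x (P h) = cinner (fst b) h - cinner (snd b - \<eta>\<^sub>c *\<^sub>C fst b) (R h)"
  shows "fst (\<Phi> b) = x"
  unfolding \<Phi>_def fst_conv by (rule the_equality) (use assms in \<open>auto intro!: cinner_P_eqI\<close>)

lemma cinner_fst_\<Phi>:
  assumes "b \<in> rel_adjoint A"
  shows "cinner (fst (\<Phi> b)) (P h) = cinner (fst b) h - cinner (snd b - \<eta>\<^sub>c *\<^sub>C fst b) (R h)"
  using exists_extended_trace[OF assms] fst_\<Phi>_eqI by metis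

lemma snd_\<Phi>: "snd (\<Phi> b) = P (snd b - \<eta>\<^sub>c *\<^sub>C fst b)"
  by (simp add: \<Phi>_def)

text \<open>
  Expressed through \<open>h = (A\<^sup>* - \<eta>) g\<close> and \<open>k = (A\<^sup>* - \<eta>) f\<close>, the two boundary terms contain
  \<open>(R k, h)\<close> and \<open>(k, R h)\<close>, which cancel because \<open>R\<close> is symmetric; the terms with \<open>\<eta>\<close> cancel because
  \<open>\<eta>\<close> is real.
\<close>

lemma green_\<Phi>:
  assumes "b \<in> rel_adjoint A" "c \<in> rel_adjoint A"
  shows "green_form b c = green_form (\<Phi> b) (\<Phi> c)"
proof -
  define h k where "h = snd c - \<eta>\<^sub>c *\<^sub>C fst c" and "k = snd b - \<eta>\<^sub>c *\<^sub>C fst b"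
  have "cinner (snd (\<Phi> b)) (fst (\<Phi> c)) = cnj (cinner (fst (\<Phi> c)) (P k))"
    by (metis cinner_commute k_def snd_\<Phi>)
  also have "\<dots> = cinner k (fst c) - cinner (R k) h"
    using cinner_fst_\<Phi>[OF assms(2), of k] by (simp add: h_def flip: cinner_commute)
  also have "cinner (R k) h = cinner k (R h)"
    by (rule R_symmetric)
  finally have "cinner (snd (\<Phi> b)) (fst (\<Phi> c)) = cinner k (fst c) - cinner k (R h)" .
  moreover have "cinner (fst (\<Phi> b)) (snd (\<Phi> c)) = cinner (fst b) h - cinner k (R h)"
    using cinner_fst_\<Phi>[OF assms(1), of h] by (simp add: snd_\<Phi> h_def k_def)
  ultimately show ?thesis
    by (simp add: green_form_def h_def k_def cinner_diff_left cinner_diff_right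
        cinner_scaleC_left cinner_scaleC_right)
qed

text \<open>
  A value \<open>x\<close> of the first component is attained at \<open>P\<^sup>* x\<close>, which lies in the eigenspace of the
  adjoint at \<open>\<eta>\<close>. A value \<open>P k\<close> of the second component is attained in the domain of \<open>A\<^sub>0\<close>, where
  the first component vanishes.
\<close>

lemma \<Phi>_onto: "\<exists>b\<in>rel_adjoint A. \<Phi> b = z"
proof -
  obtain x k where z: "z = (x, P k)"
    using surj_P by (metis surjD surj_pair)
  have "bounded_linear (\<lambda>h. inner x (P h))"
  proof -
    have "P (r *\<^sub>R h) = r *\<^sub>R P h" for r h
      unfolding scaleC_of_real[symmetric] by (rule P_scaleC)
    then have "bounded_linear P"
      using P_bounded by (intro bounded_linear.intro linearI bounded_linear_axioms.intro P_add) auto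
    then show ?thesis
      by (rule bounded_linear_compose[OF bounded_linear_inner_right])
  qed
  then obtain a where Re_a: "\<And>h. inner x (P h) = inner a h"
    using Riesz_representation by blast
  have a: "cinner x (P h) = cinner a h" for h
  proof -
    have "cinner (P h) x = cinner h a"
      by (rule cinner_eqI) (metis P_scaleC Re_a inner_commute)
    then show ?thesis
      by (metis cinner_commute)
  qed
  define b where "b = (a + R k, \<eta>\<^sub>c *\<^sub>C a + (k + \<eta>\<^sub>c *\<^sub>C R k))"
  have b_diff: "snd b - \<eta>\<^sub>c *\<^sub>C fst b = k"
    by (simp add: b_def scaleC_add_right)
  have "(a, \<eta>\<^sub>c *\<^sub>C a) \<in> rel_adjoint A"
  proof -
    have "cinner g' a = cinner g (\<eta>\<^sub>c *\<^sub>C a)" if "(g, g') \<in> A" for g g'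
    proof -
      have "R (g' - \<eta>\<^sub>c *\<^sub>C g) = g"
        using A_subset_minimal[OF that] by (simp add: R_eqI)
      then have "P (g' - \<eta>\<^sub>c *\<^sub>C g) = P 0"
        using A_subset_minimal(3)[OF that] R_scaleC[of 0 0] trace_linear(4)[OF R_in_T R_in_T, of 0 0]
        by (simp add: P_def)
      then have "cinner a (g' - \<eta>\<^sub>c *\<^sub>C g) = 0"
        using P_scaleC[of 0 0] by (simp flip: a)
      then have "cinner (g' - \<eta>\<^sub>c *\<^sub>C g) a = 0"
        by (metis cinner_commute complex_cnj_zero)
      then show ?thesis
        by (simp add: cinner_diff_left cinner_scaleC_left cinner_scaleC_right)
    qed
    then show ?thesis
      by (auto simp: rel_adjoint_def)
  qed
  then have "b \<in> rel_adjoint A"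
    unfolding b_def using R_in_T[of k] T_subset
    by (intro linear_relation_add linear_relation_rel_adjoint) auto
  moreover have "\<Phi> b = z"
  proof (rule prod_eqI)
    show "fst (\<Phi> b) = fst z"
    proof (rule fst_\<Phi>_eqI)
      fix h
      have "cinner (fst b) h = cinner (fst z) (P h) + cinner k (R h)"
        by (simp add: b_def z a R_symmetric cinner_add_left)
      then show "cinner (fst z) (P h) = cinner (fst b) h - cinner (snd b - \<eta>\<^sub>c *\<^sub>C fst b) (R h)"
        by (simp add: b_diff)
    qed
    show "snd (\<Phi> b) = snd z"
      by (simp add: snd_\<Phi> b_diff z)
  qed
  ultimately show ?thesis
    by blast
qed

sublocale ordinary_boundary_triple A \<Phi>
  using linear_A closed_A symmetric_A
  by unfold_locales (auto simp: linear_operator_def green_\<Phi> \<Phi>_onto)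

lemma \<Phi>_on_T:
  assumes "(f, f') \<in> T"
  shows "\<Phi> (f, f') = (J (\<Gamma>\<^sub>0 f), P (f' - \<eta>\<^sub>c *\<^sub>C f))"
  using fst_\<Phi>_eqI[of "J (\<Gamma>\<^sub>0 f)" "(f, f')"] cinner_trace_P[OF assms] snd_\<Phi>[of "(f, f')"]
  by (simp add: prod_eq_iff)

text \<open>
  A pair in the adjoint differs from an element of the graph of \<open>A\<^sub>0\<close> by a pair in the eigenspace at
  \<open>\<eta>\<close>, and the latter is determined by the value of the first component of \<open>\<Phi>\<close>.
\<close>

lemma T_eq_pull: "T = pull ((\<lambda>f. J (\<Gamma>\<^sub>0 f)) ` Domain T \<times> UNIV)"
proof (intro equalityI subsetI)
  fix b
  assume "b \<in> T"
  then show "b \<in> pull ((\<lambda>f. J (\<Gamma>\<^sub>0 f)) ` Domain T \<times> UNIV)"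
    using T_subset by (cases b) (auto simp: pull_def \<Phi>_on_T)
next
  fix b
  assume "b \<in> pull ((\<lambda>f. J (\<Gamma>\<^sub>0 f)) ` Domain T \<times> UNIV)"
  then obtain g g' where b: "b \<in> rel_adjoint A" and g: "(g, g') \<in> T" "fst (\<Phi> b) = J (\<Gamma>\<^sub>0 g)"
    by (auto simp: pull_def mem_Times_iff)
  define k m where "k = snd b - \<eta>\<^sub>c *\<^sub>C fst b" and "m = g' - \<eta>\<^sub>c *\<^sub>C g"
  have "cinner (fst b - R k) h = cinner (g - R m) h" for h
  proof -
    have "cinner (fst b - R k) h = cinner (fst b) h - cinner k (R h)"
      by (simp only: cinner_diff_left[of "fst b" "R k"] R_symmetric)
    also have "\<dots> = cinner g h - cinner m (R h)"
      using cinner_fst_\<Phi>[OF b, of h] cinner_trace_P[OF g(1), of h] g(2)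
      unfolding k_def m_def by (simp only:)
    also have "\<dots> = cinner (g - R m) h"
      by (simp only: cinner_diff_left[of g "R m"] R_symmetric)
    finally show ?thesis .
  qed
  then have "cinner ((fst b - R k) - (g - R m)) ((fst b - R k) - (g - R m)) = 0"
    by (simp only: cinner_diff_left[of "fst b - R k" "g - R m"]) simp
  then have "fst b - R k = g - R m"
    by simp
  then have fst_b: "fst b = (g - R m) + R k"
    by (simp only: diff_eq_eq)
  have "snd b = k + \<eta>\<^sub>c *\<^sub>C fst b"
    by (simp add: k_def)
  also have "\<dots> = (g' - (m + \<eta>\<^sub>c *\<^sub>C R m)) + (k + \<eta>\<^sub>c *\<^sub>C R k)"
    by (simp add: fst_b m_def scaleC_add_right scaleC_diff_right)
  finally have "(fst b, snd b) \<in> T"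
    unfolding fst_b by (simp only:) (intro linear_relation_add linear_relation_diff linear_T g R_in_T)
  then show "b \<in> T"
    by simp
qed

text \<open>
  On the graph of \<open>T\<close> the element \<open>f\<close> splits into \<open>R k\<close> in the domain of \<open>A\<^sub>0\<close>, with
  \<open>k = f' - \<eta> f\<close>, and an element of the eigenspace at \<open>\<eta>\<close>; subtracting \<open>M(\<eta>)\<close> removes the
  contribution of the latter to \<open>\<Gamma>\<^sub>1 f\<close>.
\<close>

lemma trace_in_theta_iff:
  assumes f: "(f, f') \<in> T"
  shows "(\<Gamma>\<^sub>0 f, \<Gamma>\<^sub>1 f) \<in> theta T \<Gamma>\<^sub>0 \<Gamma>\<^sub>1 n \<iota>\<^sub>p \<iota>\<^sub>m \<eta>\<^sub>c \<Theta> \<longleftrightarrow> \<Phi> (f, f') \<in> \<Theta>"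
proof -
  define k where "k = f' - \<eta>\<^sub>c *\<^sub>C f"
  have conj: "(g, x) \<in> graph_on UNIV (into_antidual S) O iota_conj S n \<iota>\<^sub>p \<iota>\<^sub>m \<Theta>
      \<longleftrightarrow> x \<in> S \<and> (J g, \<iota>\<^sub>p x) \<in> \<Theta>" for g x
    using into_antidual_in_antidual by (auto simp: iota_conj_def graph_on_def relcomp_unfold)
  have weyl: "(g, x) \<in> weyl_function T \<Gamma>\<^sub>0 \<Gamma>\<^sub>1 \<eta>\<^sub>c
      \<longleftrightarrow> (\<exists>u. (u, \<eta>\<^sub>c *\<^sub>C u) \<in> T \<and> \<Gamma>\<^sub>0 u = g \<and> \<Gamma>\<^sub>1 u = x)" for g x
    by (auto simp: weyl_function_def gamma_field_def graph_on_def eigenspace_def relcomp_unfold)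
  have theta: "(\<Gamma>\<^sub>0 f, \<Gamma>\<^sub>1 f) \<in> theta T \<Gamma>\<^sub>0 \<Gamma>\<^sub>1 n \<iota>\<^sub>p \<iota>\<^sub>m \<eta>\<^sub>c \<Theta> \<longleftrightarrow>
      (\<exists>x u. x \<in> S \<and> (J (\<Gamma>\<^sub>0 f), \<iota>\<^sub>p x) \<in> \<Theta> \<and> (u, \<eta>\<^sub>c *\<^sub>C u) \<in> T \<and> \<Gamma>\<^sub>0 u = \<Gamma>\<^sub>0 f \<and> \<Gamma>\<^sub>1 f = x + \<Gamma>\<^sub>1 u)"
    unfolding theta_def rel_sum_def mem_Collect_eq prod.inject conj weyl by blast
  have "(J (\<Gamma>\<^sub>0 f), P k) \<in> \<Theta>"
    if "(J (\<Gamma>\<^sub>0 f), \<iota>\<^sub>p x) \<in> \<Theta>" "(u, \<eta>\<^sub>c *\<^sub>C u) \<in> T" "\<Gamma>\<^sub>0 u = \<Gamma>\<^sub>0 f" "\<Gamma>\<^sub>1 f = x + \<Gamma>\<^sub>1 u" for x u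
  proof -
    have "R ((f' - \<eta>\<^sub>c *\<^sub>C u) - \<eta>\<^sub>c *\<^sub>C (f - u)) = f - u"
      using linear_relation_diff[OF linear_T f that(2)] trace_diff(1)[OF f that(2)] that(3)
      by (simp add: R_eqI)
    then have "R k = f - u"
      by (simp add: k_def scaleC_diff_right)
    then have "P k = \<iota>\<^sub>p x"
      using trace_diff(2)[OF f that(2)] that(4) by (simp add: P_def)
    then show ?thesis
      using that(1) by simp
  qed
  moreover have "\<Gamma>\<^sub>1 (R k) \<in> S \<and> (f - R k, \<eta>\<^sub>c *\<^sub>C (f - R k)) \<in> T \<and> \<Gamma>\<^sub>0 (f - R k) = \<Gamma>\<^sub>0 f
      \<and> \<Gamma>\<^sub>1 f = \<Gamma>\<^sub>1 (R k) + \<Gamma>\<^sub>1 (f - R k)"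
  proof -
    have "(f - R k, f' - (k + \<eta>\<^sub>c *\<^sub>C R k)) \<in> T"
      by (intro linear_relation_diff linear_T f R_in_T)
    moreover have "f' - (k + \<eta>\<^sub>c *\<^sub>C R k) = \<eta>\<^sub>c *\<^sub>C (f - R k)"
      by (simp add: k_def scaleC_diff_right)
    ultimately show ?thesis
      by (simp add: trace_R_in_G1 trace_diff[OF f R_in_T] trace_R)
  qed
  ultimately have "(\<Gamma>\<^sub>0 f, \<Gamma>\<^sub>1 f) \<in> theta T \<Gamma>\<^sub>0 \<Gamma>\<^sub>1 n \<iota>\<^sub>p \<iota>\<^sub>m \<eta>\<^sub>c \<Theta> \<longleftrightarrow> (J (\<Gamma>\<^sub>0 f), P k) \<in> \<Theta>"
    unfolding theta P_def by blast
  then show ?thesis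
    by (simp add: \<Phi>_on_T[OF f] k_def)
qed

lemma A_rel_eq_pull:
  assumes "Domain \<Theta> \<subseteq> (\<lambda>f. J (\<Gamma>\<^sub>0 f)) ` Domain T"
  shows "A_rel T \<Gamma>\<^sub>0 \<Gamma>\<^sub>1 (theta T \<Gamma>\<^sub>0 \<Gamma>\<^sub>1 n \<iota>\<^sub>p \<iota>\<^sub>m \<eta>\<^sub>c \<Theta>) = pull \<Theta>"
proof -
  have "\<Theta> \<subseteq> (\<lambda>f. J (\<Gamma>\<^sub>0 f)) ` Domain T \<times> UNIV"
    using assms by (auto dest: DomainI)
  then have "pull \<Theta> \<subseteq> T"
    by (subst T_eq_pull) (simp only: pull_mono_iff)
  then show ?thesis
    using T_subset trace_in_theta_iff by (auto simp: A_rel_def pull_def)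
qed

text \<open>This reduces every part of the theorem to a property that is invariant under preimages.\<close>

lemma bij_betw_A_rel:
  assumes "\<And>\<Theta>. linear_relation \<Theta> \<Longrightarrow> Q (pull \<Theta>) \<longleftrightarrow> Q' \<Theta>"
  shows "bij_betw (\<lambda>\<Theta>. A_rel T \<Gamma>\<^sub>0 \<Gamma>\<^sub>1 (theta T \<Gamma>\<^sub>0 \<Gamma>\<^sub>1 n \<iota>\<^sub>p \<iota>\<^sub>m \<eta>\<^sub>c \<Theta>))
    {\<Theta> \<in> {\<Theta>. linear_relation \<Theta> \<and> Domain \<Theta> \<subseteq> (\<lambda>f. J (\<Gamma>\<^sub>0 f)) ` Domain T}. Q' \<Theta>}
    {B \<in> intermediate_operators A T. Q B}"
proof -
  let ?L = "{\<Theta>. linear_relation \<Theta> \<and> Domain \<Theta> \<subseteq> (\<lambda>f. J (\<Gamma>\<^sub>0 f)) ` Domain T}"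
  have E: "intermediate_operators A T = {B. linear_relation B \<and> A \<subseteq> B \<and> B \<subseteq> T}"
    using single_valued_subset[OF _ single_valued_T]
    unfolding intermediate_operators_def linear_operator_def by blast
  have bij: "bij_betw pull ?L (intermediate_operators A T)"
    unfolding E using bij_betw_pull[of "(\<lambda>f. J (\<Gamma>\<^sub>0 f)) ` Domain T"]
    by (simp only: T_eq_pull[symmetric])
  then have "bij_betw pull {\<Theta> \<in> ?L. Q' \<Theta>} {B \<in> intermediate_operators A T. Q B}"
    by (rule bij_betw_Collect) (use assms in auto)
  then show ?thesis
    by (rule bij_betw_cong[THEN iffD1, rotated]) (auto simp: A_rel_eq_pull)
qed

end

theorem theorem3p4:
  fixes A T :: "('h::chilbert_space \<times> 'h) set"
    and \<Gamma>\<^sub>0 \<Gamma>\<^sub>1 :: "'h \<Rightarrow> 'g::chilbert_space"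
    and n :: "'g \<Rightarrow> real"
    and \<iota>\<^sub>p :: "'g \<Rightarrow> 'g"
    and \<iota>\<^sub>m :: "('g \<Rightarrow> complex) \<Rightarrow> 'g"
    and \<eta> :: real
  assumes "separable_space (euclidean :: 'h topology)"
    and "linear_operator A" and "closed A" and "closure (Domain A) = UNIV" and "rel_symmetric A"
    and "equal_deficiency_indices A"
    and "quasi_boundary_triple A T \<Gamma>\<^sub>0 \<Gamma>\<^sub>1"
    and "complex_of_real \<eta> \<in> resolvent_set (A0 T \<Gamma>\<^sub>0)"
    and "closure (G1 T \<Gamma>\<^sub>0 \<Gamma>\<^sub>1) = UNIV"
    and "admissible_norm T \<Gamma>\<^sub>0 \<Gamma>\<^sub>1 n"
    and "iota_pair (G1 T \<Gamma>\<^sub>0 \<Gamma>\<^sub>1) n \<iota>\<^sub>p \<iota>\<^sub>m"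
  shows
    "let F = (\<lambda>\<Theta>. A_rel T \<Gamma>\<^sub>0 \<Gamma>\<^sub>1 (theta T \<Gamma>\<^sub>0 \<Gamma>\<^sub>1 n \<iota>\<^sub>p \<iota>\<^sub>m (complex_of_real \<eta>) \<Theta>));
         L = {\<Theta>. linear_relation \<Theta> \<and>
                 Domain \<Theta> \<subseteq> (\<lambda>f. \<iota>\<^sub>m (into_antidual (G1 T \<Gamma>\<^sub>0 \<Gamma>\<^sub>1) (\<Gamma>\<^sub>0 f))) ` Domain T};
         E = intermediate_operators A T
     in
       bij_betw F {\<Theta> \<in> L. closed \<Theta>} {B \<in> E. closed B} \<and>
       bij_betw F {\<Theta> \<in> L. rel_symmetric \<Theta>} {B \<in> E. rel_symmetric B} \<and>
       bij_betw F {\<Theta> \<in> L. closed \<Theta> \<and> rel_symmetric \<Theta>} {B \<in> E. closed B \<and> rel_symmetric B} \<and>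
       bij_betw F {\<Theta> \<in> L. rel_selfadjoint \<Theta>} {B \<in> E. rel_selfadjoint B} \<and>
       bij_betw F {\<Theta> \<in> L. dissipative \<Theta>} {B \<in> E. dissipative B} \<and>
       bij_betw F {\<Theta> \<in> L. closed \<Theta> \<and> dissipative \<Theta>} {B \<in> E. closed B \<and> dissipative B} \<and>
       bij_betw F {\<Theta> \<in> L. maximal_with linear_relation dissipative \<Theta>}
                  {B \<in> E. maximal_with linear_operator dissipative B} \<and>
       bij_betw F {\<Theta> \<in> L. accumulative \<Theta>} {B \<in> E. accumulative B} \<and>
       bij_betw F {\<Theta> \<in> L. closed \<Theta> \<and> accumulative \<Theta>} {B \<in> E. closed B \<and> accumulative B} \<and>
       bij_betw F {\<Theta> \<in> L. maximal_with linear_relation accumulative \<Theta>}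
                  {B \<in> E. maximal_with linear_operator accumulative B}"
proof -
  interpret transformed_qbt A T \<Gamma>\<^sub>0 \<Gamma>\<^sub>1 n \<iota>\<^sub>p \<iota>\<^sub>m \<eta>
    using assms by unfold_locales
  show ?thesis
    unfolding Let_def
    by (intro conjI bij_betw_A_rel)
      (simp_all add: closed_pull_iff rel_symmetric_pull_iff rel_selfadjoint_pull_iff
        dissipative_pull_iff accumulative_pull_iff maximal_dissipative_pull_iff[OF assms(4)]
        maximal_accumulative_pull_iff[OF assms(4)])
qed

end
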